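(* (Singularity resolution and unsymmetric bounce, Giesel-Thiemann Hamiltonian with Brown-Kuchař/Gaussian dust.) Let $\beta,\kappa>0$ and consider the effective equations for $V(\tau)>0$, $b(\tau)$: $$\frac{dV}{d\tau}=-\frac{2V^{2/3}\left[9\beta^2\sin(2b)-8(\beta^2+1)\sin(4b)\right]}{9\beta},\qquad \frac{db}{d\tau}=-\frac{2\sin^2(b)\left[-\beta^2+8(\beta^2+1)\cos(2b)+8\right]}{27\beta V^{1/3}}.$$ The quantity $$\mathcal E=\frac{8V^{1/3}\sin^2(b)\left[-\beta^2+8(\beta^2+1)\cos(2b)+8\right]}{9\beta^2\kappa}=\rho V$$ is conserved in the time evolution, where $\rho>0$ is the dust energy density. Put $D=(7\beta^2+16)^2-72\beta^2(\beta^2+1)\kappa\rho V^{2/3}$. (a) For $b\in[-\pi/2,\pi/2]$ the conservation law gives the branches $$\text{(A)}\ \ b=\arcsin\left(\pm\frac{1}{4\sqrt2}\sqrt{\frac{7\beta^2+16-\sqrt D}{\beta^2+1}}\right),\qquad \text{(B)}\ \ b=\arcsin\left(\pm\frac{1}{4\sqrt2}\sqrt{\frac{7\beta^2+16+\sqrt D}{\beta^2+1}}\right),$$ on which respectively $$\text{(A)}\ \ \frac{dV}{d\tau}=\pm\frac{V^{2/3}\sqrt D}{12\sqrt2(\beta^2+1)}\sqrt{7\beta^2+4(\beta^2+1)\kappa\rho V^{2/3}-\sqrt D+16},$$ $$\text{(B)}\ \ \frac{dV}{d\tau}=\mp\frac{V^{2/3}\sqrt D}{12\sqrt2(\beta^2+1)}\sqrt{7\beta^2+4(\beta^2+1)\kappa\rho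 V^{2/3}+\sqrt D+16}.$$ (b) With $V=\mathfrak a^3$, at low density the leading order of (A) is the Friedmann equation $\left(\frac{d\mathfrak a/d\tau}{\mathfrak a}\right)^2=\frac{2(16+7\beta^2)}{81}\kappa\rho$ (up to a constant rescaling of $\tau$) without cosmological constant, whereas (B) gives $\left(\frac{d\mathfrak a/d\tau}{\mathfrak a}\right)^2=\frac{(7\beta^2+16)^3}{1296(\beta^2+1)^2\mathfrak a^2}+\frac{(-19\beta^2+8)(7\beta^2+16)\kappa\rho}{324(\beta^2+1)}+\cdots$. (c) Going back in time toward the early universe, $V$ shrinks and $\rho$ grows until $dV/d\tau=0$ is reached, which happens at the finite critical density and nonzero volume $$\rho_c=\frac{\mathcal E}{V_c},\qquad V_c=\left(\frac{6\sqrt2\,\beta}{7\beta^2+16}\right)^6(\beta^2+1)^3\kappa^3\mathcal E^3,$$ so that the big-bang singularity is replaced by a big bounce. At the bounce, set at $\tau=0$, $$\sin b(0)=\pm\frac14\sqrt{\frac{7\beta^2+16}{2(\beta^2+1)}},$$ and continuity of $\sin b$ requires that at the bounce the plus (minus) sign of the $dV/d\tau$ equation in (A) be connected to the minus (plus) sign of that in (B), i.e. the solution mixes between (A) and (B). (d) For fixed $V_c$, the effective equations admit 2 independent solutions $V(\tau)$, corresponding to $b(\tau)$ with the two different values of $b(0)$, and related by the time reflection $\tau\mapsto-\tau$. Each solution resolves the singularity and gives an unsymmetric bounce.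
   Context: $V$ is the 3-volume per lattice vertex, $b$ the holonomy angle, $\beta$ the Barbero-Immirzi parameter, $\kappa=16\pi G$, $\mathfrak a$ the scale factor, $\tau$ the dust time, and $\mathcal E$ the conserved physical (dust) energy per lattice vertex. The big-bang singularity would correspond to $V\to0$, $\rho\to\infty$. "Unsymmetric bounce" means that $V(\tau)$ is not symmetric under reflection $\tau\mapsto-\tau$ about the bounce time $\tau=0$. In (A) and (B) the upper signs correspond to each other, and likewise the lower signs. *)

theory Defs
  imports "HOL-Analysis.Analysis" "HOL-Library.Landau_Symbols"
begin

definition V_rhs :: "real \<Rightarrow> real \<Rightarrow> real \<Rightarrow> real" where
  "V_rhs \<beta> V b =
     - (2 * V powr (2/3) * (9 * \<beta>\<^sup>2 * sin (2 * b) - 8 * (\<beta>\<^sup>2 + 1) * sin (4 * b))) / (9 * \<beta>)"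

definition b_rhs :: "real \<Rightarrow> real \<Rightarrow> real \<Rightarrow> real" where
  "b_rhs \<beta> V b =
     - (2 * (sin b)\<^sup>2 * (- \<beta>\<^sup>2 + 8 * (\<beta>\<^sup>2 + 1) * cos (2 * b) + 8)) / (27 * \<beta> * V powr (1/3))"

definition effective_solution ::
    "real \<Rightarrow> real set \<Rightarrow> (real \<Rightarrow> real) \<Rightarrow> (real \<Rightarrow> real) \<Rightarrow> bool" where
  "effective_solution \<beta> I V b \<longleftrightarrow>
     open I \<and> is_interval I \<and> I \<noteq> {} \<and>
     (\<forall>\<tau>\<in>I. 0 < V \<tau> \<and>
        (V has_real_derivative V_rhs \<beta> (V \<tau>) (b \<tau>)) (at \<tau>) \<and>
        (b has_real_derivative b_rhs \<beta> (V \<tau>) (b \<tau>)) (at \<tau>))"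

definition energy :: "real \<Rightarrow> real \<Rightarrow> real \<Rightarrow> real \<Rightarrow> real" where
  "energy \<beta> \<kappa> V b =
     8 * V powr (1/3) * (sin b)\<^sup>2 * (- \<beta>\<^sup>2 + 8 * (\<beta>\<^sup>2 + 1) * cos (2 * b) + 8) / (9 * \<beta>\<^sup>2 * \<kappa>)"

definition dust_density :: "real \<Rightarrow> real \<Rightarrow> real \<Rightarrow> real \<Rightarrow> real" where
  "dust_density \<beta> \<kappa> V b = energy \<beta> \<kappa> V b / V"

definition discr :: "real \<Rightarrow> real \<Rightarrow> real \<Rightarrow> real \<Rightarrow> real" where
  "discr \<beta> \<kappa> V \<rho> = (7 * \<beta>\<^sup>2 + 16)\<^sup>2 - 72 * \<beta>\<^sup>2 * (\<beta>\<^sup>2 + 1) * \<kappa> * \<rho> * V powr (2/3)"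

datatype branch = BranchA | BranchB

text \<open>
  The sign \<open>\<sigma>\<close> is \<open>1\<close> for the upper and \<open>-1\<close> for the lower signs. It is the sign of \<open>b\<close>;
  in the volume equation of branch B it enters as \<open>-\<sigma>\<close>.
\<close>

fun branch_angle :: "real \<Rightarrow> real \<Rightarrow> branch \<Rightarrow> real \<Rightarrow> real \<Rightarrow> real \<Rightarrow> real" where
  "branch_angle \<beta> \<kappa> BranchA \<sigma> V \<rho> =
     arcsin (\<sigma> * (1 / (4 * sqrt 2)) *
       sqrt ((7 * \<beta>\<^sup>2 + 16 - sqrt (discr \<beta> \<kappa> V \<rho>)) / (\<beta>\<^sup>2 + 1)))"
| "branch_angle \<beta> \<kappa> BranchB \<sigma> V \<rho> =
     arcsin (\<sigma> * (1 / (4 * sqrt 2)) *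
       sqrt ((7 * \<beta>\<^sup>2 + 16 + sqrt (discr \<beta> \<kappa> V \<rho>)) / (\<beta>\<^sup>2 + 1)))"

fun branch_rate :: "real \<Rightarrow> real \<Rightarrow> branch \<Rightarrow> real \<Rightarrow> real \<Rightarrow> real \<Rightarrow> real" where
  "branch_rate \<beta> \<kappa> BranchA \<sigma> V \<rho> =
     \<sigma> * (V powr (2/3) * sqrt (discr \<beta> \<kappa> V \<rho>) / (12 * sqrt 2 * (\<beta>\<^sup>2 + 1)) *
       sqrt (7 * \<beta>\<^sup>2 + 4 * (\<beta>\<^sup>2 + 1) * \<kappa> * \<rho> * V powr (2/3) - sqrt (discr \<beta> \<kappa> V \<rho>) + 16))"
| "branch_rate \<beta> \<kappa> BranchB \<sigma> V \<rho> =
     - \<sigma> * (V powr (2/3) * sqrt (discr \<beta> \<kappa> V \<rho>) / (12 * sqrt 2 * (\<beta>\<^sup>2 + 1)) *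
       sqrt (7 * \<beta>\<^sup>2 + 4 * (\<beta>\<^sup>2 + 1) * \<kappa> * \<rho> * V powr (2/3) + sqrt (discr \<beta> \<kappa> V \<rho>) + 16))"

definition on_branch ::
    "real \<Rightarrow> real \<Rightarrow> branch \<Rightarrow> real \<Rightarrow> (real \<Rightarrow> real) \<Rightarrow> (real \<Rightarrow> real) \<Rightarrow> real \<Rightarrow> bool" where
  "on_branch \<beta> \<kappa> r \<sigma> V b \<tau> \<longleftrightarrow>
     (let \<rho> = dust_density \<beta> \<kappa> (V \<tau>) (b \<tau>) in
       b \<tau> = branch_angle \<beta> \<kappa> r \<sigma> (V \<tau>) \<rho> \<and>
       (V has_real_derivative branch_rate \<beta> \<kappa> r \<sigma> (V \<tau>) \<rho>) (at \<tau>))"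

text \<open>The Hubble rate on a branch: \<open>V = a\<^sup>3\<close> gives \<open>a' / a = V' / (3 V)\<close>.\<close>

definition hubble :: "real \<Rightarrow> real \<Rightarrow> branch \<Rightarrow> real \<Rightarrow> real \<Rightarrow> real \<Rightarrow> real" where
  "hubble \<beta> \<kappa> r \<sigma> V \<rho> = branch_rate \<beta> \<kappa> r \<sigma> V \<rho> / (3 * V)"

text \<open>
  The branch equations depend on \<open>\<rho>\<close> only through \<open>\<rho> V\<^sup>2\<^sup>/\<^sup>3\<close>, so low density is the joint limit
  \<open>\<rho> V\<^sup>2\<^sup>/\<^sup>3 \<rightarrow> 0\<close> over \<open>V, \<rho> > 0\<close>. It contains the limit \<open>\<rho> \<rightarrow> 0\<close> at fixed energy
  \<open>E = \<rho> V\<close>, where \<open>\<rho> V\<^sup>2\<^sup>/\<^sup>3 = E\<^sup>2\<^sup>/\<^sup>3 \<rho>\<^sup>1\<^sup>/\<^sup>3\<close>, and the limit \<open>\<rho> \<rightarrow> 0\<close> at fixed volume.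
\<close>

definition low_density :: "(real \<times> real) filter" where
  "low_density =
     inf (filtercomap (\<lambda>(V, \<rho>). \<rho> * V powr (2/3)) (at_right 0)) (principal ({0<..} \<times> {0<..}))"

definition critical_volume :: "real \<Rightarrow> real \<Rightarrow> real \<Rightarrow> real" where
  "critical_volume \<beta> \<kappa> E =
     (6 * sqrt 2 * \<beta> / (7 * \<beta>\<^sup>2 + 16)) ^ 6 * (\<beta>\<^sup>2 + 1) ^ 3 * \<kappa> ^ 3 * E ^ 3"

definition critical_sine :: "real \<Rightarrow> real" where
  "critical_sine \<beta> = 1/4 * sqrt ((7 * \<beta>\<^sup>2 + 16) / (2 * (\<beta>\<^sup>2 + 1)))"

text \<open>Contraction up to time \<open>t\<close> and expansion afterwards.\<close>

definition bounces_at :: "(real \<Rightarrow> real) \<Rightarrow> real \<Rightarrow> bool" where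
  "bounces_at V t \<longleftrightarrow>
     (\<forall>\<tau>. (V has_real_derivative 0) (at \<tau>) \<longleftrightarrow> \<tau> = t) \<and>
     strict_antimono_on {..t} V \<and> strict_mono_on {t..} V"

definition bounce_solution ::
    "real \<Rightarrow> real \<Rightarrow> real \<Rightarrow> (real \<Rightarrow> real) \<Rightarrow> (real \<Rightarrow> real) \<Rightarrow> bool" where
  "bounce_solution \<beta> \<kappa> Vc V b \<longleftrightarrow>
     effective_solution \<beta> UNIV V b \<and> (\<forall>\<tau>. 0 < dust_density \<beta> \<kappa> (V \<tau>) (b \<tau>)) \<and>
     V 0 = Vc \<and> (V has_real_derivative 0) (at 0)"

end

theory Submission
  imports Defs "HOL-Real_Asymp.Real_Asymp"
begin

text \<open>
  Write \<open>p = \<beta>\<^sup>2 + 1\<close>, \<open>q = 7\<beta>\<^sup>2 + 16\<close>, \<open>x = (sin b)\<^sup>2\<close> and \<open>G = x (q - 16 p x)\<close>. The energy is a constant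
  multiple of \<open>V\<^sup>1\<^sup>/\<^sup>3 G\<close>, so at given \<open>V\<close> and \<open>\<rho>\<close> its conservation is a quadratic equation for \<open>x\<close>,
  with \<open>\<surd>D = |q - 32 p x|\<close>, and \<open>dV/d\<tau>\<close> has the sign of \<open>sin (2b) (q - 32 p x)\<close>.

  Eliminating \<open>V\<close> gives \<open>db/d\<tau> = - const G\<^sup>2\<close>. For \<open>c = cot b\<close> and \<open>m\<^sup>2 = 9\<beta>\<^sup>2/q\<close> this reads
  \<open>dc/d\<tau> = const (c\<^sup>2 - m\<^sup>2)\<^sup>2 / (1 + c\<^sup>2)\<^sup>3\<close>. The time as a function of \<open>c\<close> is elementary and increases from
  \<open>- \<infinity>\<close> to \<open>\<infinity>\<close> on \<open>(m, \<infinity>)\<close>; hence every solution of positive density is, up to a multiple of \<open>\<pi>\<close>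
  in \<open>b\<close>, a time shift and the reflection \<open>(\<tau>, b) \<mapsto> (-\<tau>, -b)\<close>, one global flow, along which
  \<open>q - 32 p x\<close> changes sign exactly once.
\<close>

section \<open>The time as a function of the cotangent of the angle\<close>

text \<open>The density is positive exactly where \<open>G\<close> is, that is for
  \<open>|c| > m\<close>, and at fixed energy the motion of the angle decouples from
  \<open>V\<close> and can be integrated by quadrature. The cotangent is chosen because
  \<open>(sin b)\<^sup>2 = 1 / (1 + c\<^sup>2)\<close> makes the equation rational and because it
  forgets shifts of \<open>b\<close> by multiples of \<open>pi\<close>. Inverting the time then
  gives existence for all times and uniqueness together. Neither end of
  \<open>(m, \<infinity>)\<close> is reached in finite time: \<open>G\<close> enters squared, so the
  time has a pole at \<open>m\<close>, and it grows like \<open>c ^ 3 / 3\<close> at infinity. At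
  both ends \<open>G\<close> tends to \<open>0\<close>, so \<open>V\<close>, a multiple of
  \<open>1 / G ^ 3\<close>, is unbounded there; it is smallest where \<open>G\<close>, a quadratic
  in \<open>x\<close>, is largest, at \<open>x = q / (32 p)\<close>. Branches A and B are the two
  sides of this maximum. The ends lie at \<open>x = 0\<close> and \<open>x = q / (16 p)\<close>. As
  \<open>16 p - q = 9 \<beta>\<^sup>2\<close>, the second is below \<open>1\<close>, and this gap is
  the source of the asymmetry: equal volumes have \<open>x\<close>-values adding up to
  \<open>q / (16 p)\<close>, not to \<open>1\<close>.\<close>

text \<open>
  Partial fractions: with \<open>w = c\<^sup>2 - m\<^sup>2\<close> and \<open>k = 1 + m\<^sup>2\<close>, the integrand is
  \<open>(1 + c\<^sup>2)\<^sup>3 / w\<^sup>2 = w + 3 k + 3 k\<^sup>2 / w + k\<^sup>3 / w\<^sup>2\<close>.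
\<close>

definition clock :: "real \<Rightarrow> real \<Rightarrow> real" where
  "clock m c = c ^ 3 / 3 + (3 * (1 + m\<^sup>2) - m\<^sup>2) * c
     + (3 * (1 + m\<^sup>2)\<^sup>2 - (1 + m\<^sup>2) ^ 3 / (2 * m\<^sup>2)) / (2 * m) * (ln (c - m) - ln (c + m))
     - (1 + m\<^sup>2) ^ 3 / (2 * m\<^sup>2) * (c / (c\<^sup>2 - m\<^sup>2))"

lemma clock_derivative:
  assumes "0 < m" "m < c"
  shows "(clock m has_real_derivative (1 + c\<^sup>2) ^ 3 / (c\<^sup>2 - m\<^sup>2)\<^sup>2) (at c)"
proof -
  define w where "w = c\<^sup>2 - m\<^sup>2"
  define k where "k = 1 + m\<^sup>2"
  \<comment> \<open>\<open>c / w\<close> has derivative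
    \<open>- 1 / w - 2 * m\<^sup>2 / w\<^sup>2\<close>, so integrating
    \<open>k ^ 3 / w\<^sup>2\<close> by means of it adds \<open>- k ^ 3 / (2 * m\<^sup>2)\<close> to
    the coefficient \<open>3 * k\<^sup>2\<close> of \<open>1 / w\<close>.\<close>
  define A where "A = 3 * k\<^sup>2 - k ^ 3 / (2 * m\<^sup>2)"
  have w: "w > 0"
    using assms by (simp add: w_def power_strict_mono)
  have cm: "c - m > 0" "c + m > 0" using assms by auto
  have "1 / (c - m) - 1 / (c + m) = 2 * m / ((c - m) * (c + m))"
    using cm by (simp add: diff_frac_eq)
  also have "(c - m) * (c + m) = w"
    by (simp add: w_def power2_eq_square algebra_simps)
  finally have "((\<lambda>c. ln (c - m) - ln (c + m)) has_real_derivative 2 * m / w) (at c)"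
    using cm by (auto intro!: derivative_eq_intros)
  moreover have "((\<lambda>c. c / (c\<^sup>2 - m\<^sup>2)) has_real_derivative (- w - 2 * m\<^sup>2) / w\<^sup>2) (at c)"
    using w by (auto intro!: derivative_eq_intros simp: w_def power2_eq_square)
  ultimately have D: "(clock m has_real_derivative
      c\<^sup>2 + (3 * k - m\<^sup>2) + A / (2 * m) * (2 * m / w)
        - k ^ 3 / (2 * m\<^sup>2) * ((- w - 2 * m\<^sup>2) / w\<^sup>2)) (at c)"
    unfolding clock_def k_def[symmetric] A_def[symmetric]
    by (intro DERIV_diff DERIV_add DERIV_cmult) (auto intro!: derivative_eq_intros)
  have c2: "c\<^sup>2 = w + m\<^sup>2" and k2: "1 + c\<^sup>2 = w + k" by (simp_all add: w_def k_def)
  have "c\<^sup>2 + (3 * k - m\<^sup>2) + A / (2 * m) * (2 * m / w)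
        - k ^ 3 / (2 * m\<^sup>2) * ((- w - 2 * m\<^sup>2) / w\<^sup>2)
      = w + 3 * k + 3 * k\<^sup>2 / w + k ^ 3 / w\<^sup>2"
    using w assms unfolding A_def c2 by (simp add: field_simps power2_eq_square)
  also have "\<dots> = (w + k) ^ 3 / w\<^sup>2"
    using w by (simp add: field_simps power2_eq_square power3_eq_cube)
  finally have "(clock m has_real_derivative (w + k) ^ 3 / w\<^sup>2) (at c)"
    using D by (simp only:)
  then show ?thesis by (simp only: k2 w_def)
qed

lemma clock_at_top:
  assumes "0 < m" shows "filterlim (clock m) at_top at_top"
  unfolding clock_def using assms by real_asymp

text \<open>At \<open>m\<close> the logarithm and the rational term both diverge, and the
  coefficient of the logarithm has no fixed sign. The pole wins: after multiplication by
  \<open>h = c - m\<close> the logarithm vanishes in the limit and the pole leaves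
  \<open>- k ^ 3 / (4 * m\<^sup>2) < 0\<close>. \<open>R h\<close> is this product, with
  \<open>h\<close> cancelled in the pole.\<close>

lemma clock_at_bot:
  assumes "0 < m" shows "filterlim (clock m) at_bot (at_right m)"
proof -
  define k A where "k = 1 + m\<^sup>2" and "A = (3 * k\<^sup>2 - k ^ 3 / (2 * m\<^sup>2)) / (2 * m)"
  define R where "R h = h * ((m + h) ^ 3 / 3 + (3 * k - m\<^sup>2) * (m + h))
    + A * (h * ln h - h * ln (2 * m + h)) - k ^ 3 / (2 * m\<^sup>2) * ((m + h) / (2 * m + h))" for h
  have "((\<lambda>h::real. h * ln h) \<longlongrightarrow> 0) (at_right 0)"
    by real_asymp
  then have "(R \<longlongrightarrow> 0 * ((m + 0) ^ 3 / 3 + (3 * k - m\<^sup>2) * (m + 0))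
    + A * (0 - 0 * ln (2 * m + 0)) - k ^ 3 / (2 * m\<^sup>2) * ((m + 0) / (2 * m + 0))) (at_right 0)"
    unfolding R_def using assms by (intro tendsto_intros) auto
  moreover have "k > 0" by (simp add: k_def add_pos_nonneg)
  ultimately have R: "(R \<longlongrightarrow> - (k ^ 3 / (4 * m\<^sup>2))) (at_right 0)" "- (k ^ 3 / (4 * m\<^sup>2)) < 0"
    using assms by auto
  have "filterlim (\<lambda>h::real. inverse h) at_top (at_right 0)"
    by (rule filterlim_inverse_at_top_right)
  then have "filterlim (\<lambda>h. R h * inverse h) at_bot (at_right 0)"
    using R by (intro filterlim_tendsto_neg_mult_at_bot[of R "- (k ^ 3 / (4 * m\<^sup>2))"])
  moreover have "\<forall>\<^sub>F h in at_right 0. R h * inverse h = clock m (m + h)"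
  proof (rule eventually_at_rightI[of 0 1])
    fix h :: real assume "h \<in> {0<..<1}"
    then have h: "h > 0" by simp
    have "(m + h)\<^sup>2 - m\<^sup>2 = (2 * m + h) * h"
      by (simp add: power2_eq_square algebra_simps)
    moreover have "(h * ln h - h * ln (2 * m + h)) / h = ln h - ln (2 * m + h)"
      using h by (simp add: field_simps)
    moreover have "(h * P + A * Q - B * S) / h = P + A * (Q / h) - B * (S / h)" for P Q B S
      using h by (simp add: add_divide_distrib diff_divide_distrib)
    then have "R h / h = ((m + h) ^ 3 / 3 + (3 * k - m\<^sup>2) * (m + h))
      + A * ((h * ln h - h * ln (2 * m + h)) / h)
      - k ^ 3 / (2 * m\<^sup>2) * ((m + h) / (2 * m + h) / h)"
      unfolding R_def .
    ultimately show "R h * inverse h = clock m (m + h)"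
      unfolding clock_def k_def[symmetric] A_def[symmetric] divide_inverse[of "R h", symmetric]
      by (simp add: add.commute add.left_commute)
  qed simp
  ultimately have "filterlim (\<lambda>h. clock m (m + h)) at_bot (at_right 0)"
    by (simp cong: filterlim_cong)
  then show ?thesis
    by (subst at_right_to_0) (simp add: filterlim_filtermap add.commute)
qed

lemma clock_strict_mono:
  assumes "0 < m" shows "strict_mono_on {m<..} (clock m)"
proof (rule strict_mono_onI)
  fix c d assume c: "c \<in> {m<..}" "d \<in> {m<..}" "c < d"
  show "clock m c < clock m d"
  proof (rule DERIV_pos_imp_increasing[OF \<open>c < d\<close>])
    fix x assume "c \<le> x" "x \<le> d"
    then have "m < x" using c by auto
    moreover from this have "x\<^sup>2 - m\<^sup>2 > 0"
      using assms by (simp add: power_strict_mono)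
    ultimately show "\<exists>y. (clock m has_real_derivative y) (at x) \<and> 0 < y"
      using clock_derivative[OF assms]
      by (intro exI[of _ "(1 + x\<^sup>2) ^ 3 / (x\<^sup>2 - m\<^sup>2)\<^sup>2"] conjI) (auto intro!: divide_pos_pos zero_less_power add_pos_nonneg)
  qed
qed

lemma clock_bij:
  assumes "0 < m" shows "bij_betw (clock m) {m<..} UNIV"
proof -
  have "\<exists>c. m < c \<and> clock m c = s" for s
  proof -
    have "eventually (\<lambda>c. clock m c \<le> s) (at_right m)"
      using clock_at_bot[OF assms] by (simp add: filterlim_at_bot)
    then obtain e where "e > m" "\<And>c. m < c \<Longrightarrow> c < e \<Longrightarrow> clock m c \<le> s"
      by (auto simp: eventually_at_right_field)
    then have a: "m < (m + e) / 2" "clock m ((m + e) / 2) \<le> s" by auto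
    have "eventually (\<lambda>c. clock m c \<ge> s) at_top"
      using clock_at_top[OF assms] by (simp add: filterlim_at_top)
    then obtain N where "\<And>c. c \<ge> N \<Longrightarrow> s \<le> clock m c"
      by (auto simp: eventually_at_top_linorder)
    then have b: "s \<le> clock m (max N ((m + e) / 2))" by simp
    have "\<forall>c. (m + e) / 2 \<le> c \<and> c \<le> max N ((m + e) / 2) \<longrightarrow> isCont (clock m) c"
      using a clock_derivative[OF assms] DERIV_isCont by (metis less_le_trans)
    then obtain c where "(m + e) / 2 \<le> c" "clock m c = s"
      using IVT[of "clock m" "(m + e) / 2" s, OF a(2) b] by auto
    then show ?thesis using less_le_trans[OF a(1)] by blast
  qed
  then have "clock m ` {m<..} = UNIV" by (metis UNIV_eq_I greaterThan_iff image_eqI)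
  then show ?thesis
    using clock_strict_mono[OF assms, THEN strict_mono_on_imp_inj_on]
    by (simp add: bij_betw_def)
qed

definition cot_flow :: "real \<Rightarrow> real \<Rightarrow> real" where
  "cot_flow m = the_inv_into {m<..} (clock m)"

lemma cot_flow:
  assumes "0 < m"
  shows cot_flow_gt: "m < cot_flow m s"
    and clock_cot_flow: "clock m (cot_flow m s) = s"
    and cot_flow_clock: "m < c \<Longrightarrow> cot_flow m (clock m c) = c"
proof -
  have "cot_flow m s \<in> {m<..}"
    using clock_bij[OF assms] unfolding cot_flow_def
    by (intro the_inv_into_into) (auto simp: bij_betw_def)
  then show "m < cot_flow m s" by simp
  show "clock m (cot_flow m s) = s"
    using clock_bij[OF assms] unfolding cot_flow_def
    by (intro f_the_inv_into_f) (auto simp: bij_betw_def)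
  show "cot_flow m (clock m c) = c" if "m < c"
    using clock_bij[OF assms] that unfolding cot_flow_def
    by (intro the_inv_into_f_f) (auto simp: bij_betw_def)
qed

lemma cot_flow_derivative:
  assumes "0 < m"
  shows "(cot_flow m has_real_derivative
    ((cot_flow m s)\<^sup>2 - m\<^sup>2)\<^sup>2 / (1 + (cot_flow m s)\<^sup>2) ^ 3) (at s)"
proof -
  let ?c = "cot_flow m s"
  have c: "m < ?c" by (rule cot_flow_gt[OF assms])
  have w: "?c\<^sup>2 - m\<^sup>2 > 0"
    using c assms by (simp add: power_strict_mono)
  have "((1 + ?c\<^sup>2) ^ 3 / (?c\<^sup>2 - m\<^sup>2)\<^sup>2) \<noteq> 0"
    using w by (simp add: add_nonneg_eq_0_iff)
  moreover have "isCont (cot_flow m) (clock m ?c)"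
  \<comment> \<open>This interval around \<open>?c\<close> stays to the right of \<open>m\<close>,
    where \<open>cot_flow m\<close> inverts \<open>clock m\<close>.\<close>
  proof (rule isCont_inverse_function2[where f = "clock m" and a = "(m + ?c) / 2" and b = "?c + 1"])
    fix z assume "(m + ?c) / 2 \<le> z"
    then have "m < z" using c by (simp add: field_simps)
    then show "cot_flow m (clock m z) = z" "isCont (clock m) z"
      using cot_flow_clock[OF assms] clock_derivative[OF assms] by (auto intro: DERIV_isCont)
  qed (use c in auto)
  ultimately have "(cot_flow m has_real_derivative inverse ((1 + ?c\<^sup>2) ^ 3 / (?c\<^sup>2 - m\<^sup>2)\<^sup>2)) (at s)"
    by (intro DERIV_inverse_function[OF _ _ , where a = "s - 1" and b = "s + 1" and f = "clock m"]
         clock_derivative[OF assms c])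
       (auto simp: cot_flow[OF assms])
  then show ?thesis by (simp add: cot_flow[OF assms])
qed

lemma cot_flow_strict_mono:
  assumes "0 < m" shows "strict_mono (cot_flow m)"
  using clock_strict_mono[OF assms] cot_flow[OF assms]
  by (metis (no_types, lifting) greaterThan_iff linorder_less_linear order_less_asym' strict_monoI strict_mono_onD)

text \<open>Separation of variables: \<open>clock m (f t) - a * t\<close> has derivative zero. The
  factor \<open>a\<close> carries the energy scale and, when negative, a reversal of time.\<close>

lemma cot_flow_unique:
  fixes f :: "real \<Rightarrow> real"
  assumes "0 < m" "convex I" "\<And>t. t \<in> I \<Longrightarrow> m < f t"
    and "\<And>t. t \<in> I \<Longrightarrow> (f has_real_derivative a * (((f t)\<^sup>2 - m\<^sup>2)\<^sup>2 / (1 + (f t)\<^sup>2) ^ 3)) (at t)"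
  obtains d where "\<And>t. t \<in> I \<Longrightarrow> f t = cot_flow m (a * t + d)"
proof -
  have "\<exists>d. \<forall>t\<in>I. clock m (f t) - a * t = d"
  proof (rule has_field_derivative_zero_constant[OF \<open>convex I\<close>])
    fix t assume t: "t \<in> I"
    have w: "(f t)\<^sup>2 - m\<^sup>2 > 0"
      using assms(3)[OF t] assms(1) by (simp add: power_strict_mono)
    have q: "1 + (f t)\<^sup>2 > 0" by (simp add: add_pos_nonneg)
    have "((\<lambda>t. clock m (f t) - a * t) has_real_derivative
       (1 + (f t)\<^sup>2) ^ 3 / ((f t)\<^sup>2 - m\<^sup>2)\<^sup>2 * (a * (((f t)\<^sup>2 - m\<^sup>2)\<^sup>2 / (1 + (f t)\<^sup>2) ^ 3)) - a) (at t)"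
      by (intro DERIV_diff DERIV_chain2[of "clock m" _ f] clock_derivative assms(1) assms(3,4)[OF t])
         (auto intro!: derivative_eq_intros)
    moreover have "(1 + (f t)\<^sup>2) ^ 3 / ((f t)\<^sup>2 - m\<^sup>2)\<^sup>2 * (a * (((f t)\<^sup>2 - m\<^sup>2)\<^sup>2 / (1 + (f t)\<^sup>2) ^ 3)) - a = 0"
      using w q by simp
    ultimately show "((\<lambda>t. clock m (f t) - a * t) has_real_derivative 0) (at t within I)"
      by (metis has_field_derivative_at_within)
  qed
  then obtain d where "\<And>t. t \<in> I \<Longrightarrow> clock m (f t) = a * t + d"
    by (metis add_diff_cancel_left' diff_add_cancel add.commute)
  then show ?thesis using that assms cot_flow_clock by metis
qed

section \<open>Energy and branches\<close>

lemma powr_two_thirds: "(V::real) powr (2/3) = (V powr (1/3))\<^sup>2"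
  by (cases "V = 0") (simp_all add: powr_powr flip: powr_numeral)

lemma cube_root_cubed: "0 < (V::real) \<Longrightarrow> (V powr (1/3)) ^ 3 = V"
  by (simp add: powr_powr flip: powr_numeral)

lemma cubed_cube_root: "0 < (u::real) \<Longrightarrow> (u ^ 3) powr (1/3) = u"
  by (simp add: powr_powr flip: powr_numeral)

locale dust_model =
  fixes \<beta> \<kappa> :: real
  assumes \<beta>_pos: "0 < \<beta>" and \<kappa>_pos: "0 < \<kappa>"
begin

definition p :: real where "p = \<beta>\<^sup>2 + 1"

definition q :: real where "q = 7 * \<beta>\<^sup>2 + 16"

definition G :: "real \<Rightarrow> real" where
  "G b = (sin b)\<^sup>2 * (q - 16 * p * (sin b)\<^sup>2)"

lemma p_pos: "0 < p" and q_pos: "0 < q"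
  by (simp_all add: p_def q_def add_nonneg_pos)

text \<open>The gap is \<open>9 * \<beta>\<^sup>2\<close>, so strictness comes from \<beta> being
  nonzero. It places the nontrivial zero of the energy at an angle with
  \<open>(sin b)\<^sup>2 < 1\<close> and later excludes a symmetric bounce.\<close>

lemma q_less: "q < 16 * p"
  using \<beta>_pos by (simp add: p_def q_def)

lemma pq: "16 * p - q = 9 * \<beta>\<^sup>2"
  by (simp add: p_def q_def)

lemma cos_term: "- \<beta>\<^sup>2 + 8 * (\<beta>\<^sup>2 + 1) * cos (2 * b) + 8 = q - 16 * p * (sin b)\<^sup>2"
  unfolding cos_double_sin p_def q_def by (simp add: algebra_simps)

lemma V_rhs_eq:
  "V_rhs \<beta> V b = 2 * (V powr (1/3))\<^sup>2 * sin (2 * b) * (q - 32 * p * (sin b)\<^sup>2) / (9 * \<beta>)"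
proof -
  have "sin (4 * b) = 2 * sin (2 * b) * (1 - 2 * (sin b)\<^sup>2)"
    using sin_double[of "2 * b"] by (simp add: cos_double_sin)
  then have "9 * \<beta>\<^sup>2 * sin (2 * b) - 8 * (\<beta>\<^sup>2 + 1) * sin (4 * b)
      = - (sin (2 * b) * (q - 32 * p * (sin b)\<^sup>2))"
    by (simp only: p_def q_def) (simp only: algebra_simps)
  then show ?thesis
    unfolding V_rhs_def by (simp add: powr_two_thirds)
qed

lemma b_rhs_eq: "b_rhs \<beta> V b = - (2 * G b / (27 * \<beta> * V powr (1/3)))"
  unfolding b_rhs_def G_def cos_term by (simp add: mult.assoc)

lemma energy_eq: "energy \<beta> \<kappa> V b = 8 * V powr (1/3) * G b / (9 * \<beta>\<^sup>2 * \<kappa>)"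
  unfolding energy_def G_def cos_term by (simp add: mult.assoc)

lemma dust_density_pos_iff: "0 < V \<Longrightarrow> 0 < dust_density \<beta> \<kappa> V b \<longleftrightarrow> 0 < G b"
proof -
  assume V: "0 < V"
  have "dust_density \<beta> \<kappa> V b = G b * (8 * V powr (1/3) / (9 * \<beta>\<^sup>2 * \<kappa> * V))"
    by (simp add: dust_density_def energy_eq)
  moreover have "0 < 8 * V powr (1/3) / (9 * \<beta>\<^sup>2 * \<kappa> * V)"
    using V \<beta>_pos \<kappa>_pos by simp
  ultimately show ?thesis by (metis zero_less_mult_iff order_less_asym)
qed

lemma effective_solutionD:
  assumes "effective_solution \<beta> I V b" "\<tau> \<in> I"
  shows "0 < V \<tau>"
    and "(V has_real_derivative V_rhs \<beta> (V \<tau>) (b \<tau>)) (at \<tau>)"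
    and "(b has_real_derivative b_rhs \<beta> (V \<tau>) (b \<tau>)) (at \<tau>)"
  using assms by (auto simp: effective_solution_def)

section \<open>Conservation of the energy\<close>

lemma G_derivative:
  "(G has_real_derivative sin (2 * b) * (q - 32 * p * (sin b)\<^sup>2)) (at b)"
  unfolding G_def sin_double
  by (auto intro!: derivative_eq_intros simp: algebra_simps power2_eq_square)

text \<open>With \<open>h = V powr (1/3) * G b\<close>, the equations are Hamilton's equations up to
  the common factor \<open>f = 2 * V powr (1/3) / (9 * \<beta>)\<close>: \<open>V'\<close> is
  \<open>f\<close> times the derivative of \<open>h\<close> in \<open>b\<close>, and
  \<open>b'\<close> is \<open>- f\<close> times its derivative in \<open>V\<close>. Hence
  \<open>h\<close> is constant, and the energy is a multiple of it.\<close>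

lemma energy_conserved:
  assumes "effective_solution \<beta> I V b"
  obtains E where "\<And>\<tau>. \<tau> \<in> I \<Longrightarrow> energy \<beta> \<kappa> (V \<tau>) (b \<tau>) = E"
proof -
  have "\<exists>E. \<forall>\<tau>\<in>I. energy \<beta> \<kappa> (V \<tau>) (b \<tau>) = E"
  proof (rule has_field_derivative_zero_constant)
    show "convex I"
      using assms by (simp add: effective_solution_def is_interval_convex_1)
    fix \<tau> assume \<tau>: "\<tau> \<in> I"
    note sol = effective_solutionD[OF assms \<tau>]
    define u where "u = V \<tau> powr (1/3)"
    have u: "u > 0" using sol(1) by (simp add: u_def)
    have "((\<lambda>t. V t powr (1/3)) has_real_derivative
        1 / 3 * V \<tau> powr (1/3 - 1) * V_rhs \<beta> (V \<tau>) (b \<tau>)) (at \<tau>)" (is ?du)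
      by (rule DERIV_chain2[OF has_real_derivative_powr[OF sol(1)] sol(2)])
    have "V \<tau> powr (1/3 - 1) = u / V \<tau>"
      using sol(1) powr_diff[of "V \<tau>" "1/3" 1] by (simp add: u_def)
    moreover have "V \<tau> = u ^ 3" using cube_root_cubed[OF sol(1)] by (simp add: u_def)
    then have "u / V \<tau> = 1 / u\<^sup>2" using u by (simp add: power2_eq_square power3_eq_cube)
    ultimately have "V \<tau> powr (1/3 - 1) = 1 / u\<^sup>2" by (simp only:)
    with \<open>?du\<close>
    have du: "((\<lambda>t. V t powr (1/3)) has_real_derivative
        2 * sin (2 * b \<tau>) * (q - 32 * p * (sin (b \<tau>))\<^sup>2) / (27 * \<beta>)) (at \<tau>)"
      using u by (simp add: V_rhs_eq u_def[symmetric] mult.assoc)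
    have "((\<lambda>t. G (b t)) has_real_derivative
        sin (2 * b \<tau>) * (q - 32 * p * (sin (b \<tau>))\<^sup>2) * - (2 * G (b \<tau>) / (27 * \<beta> * u))) (at \<tau>)"
    proof (rule DERIV_chain2[OF G_derivative])
      show "(b has_real_derivative - (2 * G (b \<tau>) / (27 * \<beta> * u))) (at \<tau>)"
        using sol(3) by (simp add: b_rhs_eq u_def)
    qed
    from DERIV_cmult[OF DERIV_mult[OF du this], of "8 / (9 * \<beta>\<^sup>2 * \<kappa>)"]
    have "((\<lambda>t. 8 / (9 * \<beta>\<^sup>2 * \<kappa>) * (V t powr (1/3) * G (b t))) has_real_derivative 0) (at \<tau>)"
      using u by (simp add: u_def[symmetric])
    then show "((\<lambda>t. energy \<beta> \<kappa> (V t) (b t)) has_real_derivative 0) (at \<tau> within I)"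
      by (simp add: energy_eq has_field_derivative_at_within mult.assoc)
  qed
  then show ?thesis using that by blast
qed

section \<open>The discriminant and the branches of the angle\<close>

lemma dust_density_scaled:
  assumes "0 < V"
  shows "\<kappa> * dust_density \<beta> \<kappa> V b * V powr (2/3) = 8 * G b / (9 * \<beta>\<^sup>2)"
proof -
  define u where "u = V powr (1/3)"
  have u: "u > 0" using assms by (simp add: u_def)
  have V: "V = u ^ 3" using cube_root_cubed[OF assms] by (simp add: u_def)
  have "dust_density \<beta> \<kappa> V b = 8 * u * G b / (9 * \<beta>\<^sup>2 * \<kappa>) / u ^ 3"
    by (simp add: dust_density_def energy_eq u_def[symmetric] V[symmetric])
  then show ?thesis
    using u \<kappa>_pos by (simp add: powr_two_thirds u_def[symmetric] power2_eq_square power3_eq_cube)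
qed

lemma discr_alt: "discr \<beta> \<kappa> V \<rho> = q\<^sup>2 - 72 * \<beta>\<^sup>2 * p * (\<kappa> * \<rho> * V powr (2/3))"
  by (simp add: discr_def p_def q_def)

text \<open>In \<open>\<kappa> * \<rho> * V powr (2/3)\<close> the volume cancels, so the
  discriminant depends on the angle alone: it is \<open>64 p\<close> times the gap between
  \<open>G\<close> and its maximum \<open>q\<^sup>2 / (64 p)\<close>. Completing the square in
  \<open>(sin b)\<^sup>2\<close> turns this gap into a square, zero only at
  \<open>(sin b)\<^sup>2 = q / (32 p)\<close>.\<close>

lemma discr_dust_density:
  assumes "0 < V"
  shows "discr \<beta> \<kappa> V (dust_density \<beta> \<kappa> V b) = (q - 32 * p * (sin b)\<^sup>2)\<^sup>2"
proof -
  have "discr \<beta> \<kappa> V (dust_density \<beta> \<kappa> V b) = q\<^sup>2 - 64 * p * G b"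
    using \<beta>_pos by (simp add: discr_alt dust_density_scaled[OF assms])
  then show ?thesis by (simp add: G_def power2_eq_square algebra_simps)
qed

lemma discr_less: "0 < V \<Longrightarrow> 0 < \<rho> \<Longrightarrow> discr \<beta> \<kappa> V \<rho> < q\<^sup>2"
  using \<beta>_pos \<kappa>_pos p_pos by (simp add: discr_alt)

text \<open>The two roots of the quadratic equation for \<open>(sin b)\<^sup>2\<close> that energy conservation amounts to.\<close>

fun branch_root :: "branch \<Rightarrow> real \<Rightarrow> real" where
  "branch_root BranchA D = (q - sqrt D) / (32 * p)"
| "branch_root BranchB D = (q + sqrt D) / (32 * p)"

lemma branch_angle_eq:
  "branch_angle \<beta> \<kappa> r \<sigma> V \<rho> = arcsin (\<sigma> * sqrt (branch_root r (discr \<beta> \<kappa> V \<rho>)))"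
proof -
  have 32: "4 * sqrt 2 = sqrt 32" by (rule real_sqrt_unique[symmetric]) (auto simp: power_mult_distrib)
  have "\<sigma> * (1 / (4 * sqrt 2)) * sqrt (y / p) = \<sigma> * sqrt (y / (32 * p))" for y
    unfolding 32 by (simp add: real_sqrt_divide real_sqrt_mult)
  then show ?thesis
    by (cases r) (simp_all only: branch_angle.simps branch_root.simps p_def[symmetric] q_def[symmetric])
qed

lemma branch_root_bounds:
  assumes "0 \<le> D" "D \<le> q\<^sup>2"
  shows "0 \<le> branch_root r D" "branch_root r D \<le> 1"
proof -
  have D: "0 \<le> sqrt D" "sqrt D \<le> q"
    using assms q_pos by (auto intro: real_le_lsqrt)
  then show "0 \<le> branch_root r D"
    using p_pos q_pos by (cases r) auto
  show "branch_root r D \<le> 1"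
  proof -
    have "q - sqrt D \<le> 32 * p" "q + sqrt D \<le> 32 * p"
      using D q_less q_pos by linarith+
    then show ?thesis using p_pos by (cases r) auto
  qed
qed

lemma sin_branch_angle:
  assumes "0 < V" "0 < \<rho>" "0 \<le> discr \<beta> \<kappa> V \<rho>" "\<sigma> \<in> {1, -1}"
  shows "sin (branch_angle \<beta> \<kappa> r \<sigma> V \<rho>) = \<sigma> * sqrt (branch_root r (discr \<beta> \<kappa> V \<rho>))"
    and "branch_angle \<beta> \<kappa> r \<sigma> V \<rho> \<in> {-pi/2..pi/2}"
proof -
  have D: "discr \<beta> \<kappa> V \<rho> \<le> q\<^sup>2" using discr_less[OF assms(1,2)] by simp
  have "sqrt (branch_root r (discr \<beta> \<kappa> V \<rho>)) \<le> 1"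
       "0 \<le> sqrt (branch_root r (discr \<beta> \<kappa> V \<rho>))"
    using branch_root_bounds[OF assms(3) D, of r] by auto
  then have y: "\<bar>\<sigma> * sqrt (branch_root r (discr \<beta> \<kappa> V \<rho>))\<bar> \<le> 1"
    using assms(4) by auto
  show "sin (branch_angle \<beta> \<kappa> r \<sigma> V \<rho>) = \<sigma> * sqrt (branch_root r (discr \<beta> \<kappa> V \<rho>))"
    unfolding branch_angle_eq using y by (intro sin_arcsin) (auto simp: abs_le_iff)
  show "branch_angle \<beta> \<kappa> r \<sigma> V \<rho> \<in> {-pi/2..pi/2}"
    unfolding branch_angle_eq using y arcsin_bounded[of "\<sigma> * sqrt (branch_root r (discr \<beta> \<kappa> V \<rho>))"]
    by (auto simp: abs_le_iff)
qed

text \<open>The sign of \<open>q - 32 p (sin b)\<^sup>2\<close> tells the branches apart.\<close>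

fun branch_sign :: "branch \<Rightarrow> real" where
  "branch_sign BranchA = 1"
| "branch_sign BranchB = -1"

lemma branch_root_eq: "branch_root r D = (q - branch_sign r * sqrt D) / (32 * p)"
  by (cases r) simp_all

text \<open>The sign conditions are weak on purpose: at \<open>sin b = 0\<close> either sign serves,
  and where \<open>q - 32 p (sin b)\<^sup>2\<close> vanishes the two branches meet.\<close>

lemma branch_angle_dust_density:
  assumes "0 < V" "b \<in> {-pi/2..pi/2}" "\<sigma> * \<bar>sin b\<bar> = sin b"
    and "0 \<le> branch_sign r * (q - 32 * p * (sin b)\<^sup>2)"
  shows "b = branch_angle \<beta> \<kappa> r \<sigma> V (dust_density \<beta> \<kappa> V b)"
proof -
  have "branch_sign r * sqrt (discr \<beta> \<kappa> V (dust_density \<beta> \<kappa> V b)) = q - 32 * p * (sin b)\<^sup>2"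
    using assms(4) by (cases r) (auto simp: discr_dust_density[OF assms(1)])
  then have "branch_root r (discr \<beta> \<kappa> V (dust_density \<beta> \<kappa> V b)) = (sin b)\<^sup>2"
    using p_pos by (simp add: branch_root_eq)
  then show ?thesis
    using assms(2,3) by (simp add: branch_angle_eq arcsin_sin)
qed

lemma branch_angle_sin_squared:
  assumes "0 < V" "0 < \<rho>" "0 \<le> discr \<beta> \<kappa> V \<rho>" "\<sigma> \<in> {1, -1}"
    and "b = branch_angle \<beta> \<kappa> r \<sigma> V \<rho>"
  shows "branch_sign r * sqrt (discr \<beta> \<kappa> V \<rho>) = q - 32 * p * (sin b)\<^sup>2"
    and "sin b = \<sigma> * \<bar>sin b\<bar>"
proof -
  define D where "D = discr \<beta> \<kappa> V \<rho>"
  have D: "0 \<le> D" "D \<le> q\<^sup>2" using discr_less[OF assms(1,2)] assms(3) by (auto simp: D_def)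
  have s: "sin b = \<sigma> * sqrt (branch_root r D)"
    using sin_branch_angle(1)[OF assms(1-4)] by (simp add: assms(5) D_def)
  have r0: "0 \<le> branch_root r D" by (rule branch_root_bounds[OF D])
  then have "(sin b)\<^sup>2 = branch_root r D"
    using assms(4) by (auto simp: s)
  then show "branch_sign r * sqrt (discr \<beta> \<kappa> V \<rho>) = q - 32 * p * (sin b)\<^sup>2"
    using p_pos by (simp add: branch_root_eq D_def)
  show "sin b = \<sigma> * \<bar>sin b\<bar>"
    using assms(4) r0 by (auto simp: s)
qed

text \<open>For the converse, the branch formula says that
  \<open>(q - 32 p (sin b)\<^sup>2)\<^sup>2\<close> is the discriminant at \<rho>. It is also the
  discriminant at the actual density of \<open>(V, b)\<close>, and the discriminant is injective in
  the density.\<close>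

lemma energy_iff_branch:
  assumes "0 < V" "0 < \<rho>" "b \<in> {-pi/2..pi/2}"
  shows "energy \<beta> \<kappa> V b = \<rho> * V \<longleftrightarrow>
    0 \<le> discr \<beta> \<kappa> V \<rho> \<and> (\<exists>r. \<exists>\<sigma>\<in>{1, -1}. b = branch_angle \<beta> \<kappa> r \<sigma> V \<rho>)"
proof
  assume "energy \<beta> \<kappa> V b = \<rho> * V"
  then have \<rho>: "\<rho> = dust_density \<beta> \<kappa> V b"
    using assms(1) by (simp add: dust_density_def)
  define r where "r = (if q - 32 * p * (sin b)\<^sup>2 \<ge> 0 then BranchA else BranchB)"
  define \<sigma> :: real where "\<sigma> = (if sin b \<ge> 0 then 1 else -1)"
  have "b = branch_angle \<beta> \<kappa> r \<sigma> V \<rho>"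
    unfolding \<rho> by (rule branch_angle_dust_density[OF assms(1,3)]) (auto simp: r_def \<sigma>_def)
  moreover have "\<sigma> \<in> {1, -1}" by (auto simp: \<sigma>_def)
  ultimately show "0 \<le> discr \<beta> \<kappa> V \<rho> \<and> (\<exists>r. \<exists>\<sigma>\<in>{1, -1}. b = branch_angle \<beta> \<kappa> r \<sigma> V \<rho>)"
    using discr_dust_density[OF assms(1)] \<rho> by auto
next
  assume "0 \<le> discr \<beta> \<kappa> V \<rho> \<and> (\<exists>r. \<exists>\<sigma>\<in>{1, -1}. b = branch_angle \<beta> \<kappa> r \<sigma> V \<rho>)"
  then obtain r \<sigma> where D: "0 \<le> discr \<beta> \<kappa> V \<rho>" and "\<sigma> \<in> {1, -1}" "b = branch_angle \<beta> \<kappa> r \<sigma> V \<rho>"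
    by auto
  then have "branch_sign r * sqrt (discr \<beta> \<kappa> V \<rho>) = q - 32 * p * (sin b)\<^sup>2"
    using branch_angle_sin_squared(1)[OF assms(1,2)] by blast
  then have "(branch_sign r * sqrt (discr \<beta> \<kappa> V \<rho>))\<^sup>2 = discr \<beta> \<kappa> V (dust_density \<beta> \<kappa> V b)"
    by (simp add: discr_dust_density[OF assms(1)])
  then have "discr \<beta> \<kappa> V \<rho> = discr \<beta> \<kappa> V (dust_density \<beta> \<kappa> V b)"
    using D by (cases r) auto
  then have "\<rho> = dust_density \<beta> \<kappa> V b"
    using \<beta>_pos \<kappa>_pos p_pos assms(1) by (auto simp: discr_alt)
  then show "energy \<beta> \<kappa> V b = \<rho> * V"
    using assms(1) by (simp add: dust_density_def)
qed

lemma branch_rate_eq: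
  "branch_rate \<beta> \<kappa> r \<sigma> V \<rho> = \<sigma> * (V powr (2/3) * (branch_sign r * sqrt (discr \<beta> \<kappa> V \<rho>)) / (12 * sqrt 2 * p) *
     sqrt (q + 4 * p * (\<kappa> * \<rho> * V powr (2/3)) - branch_sign r * sqrt (discr \<beta> \<kappa> V \<rho>)))"
proof -
  have "sqrt (7 * \<beta>\<^sup>2 + 4 * (\<beta>\<^sup>2 + 1) * \<kappa> * \<rho> * V powr (2/3) + y + 16)
      = sqrt (q + 4 * p * (\<kappa> * \<rho> * V powr (2/3)) + y)" for y
    by (simp add: p_def q_def algebra_simps)
  from this[of "sqrt (discr \<beta> \<kappa> V \<rho>)"] this[of "- sqrt (discr \<beta> \<kappa> V \<rho>)"]
  show ?thesis
    by (cases r) (simp_all add: p_def[symmetric])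
qed

text \<open>With \<open>x = (sin b)\<^sup>2\<close>, the radicand of the second root in the rate
  becomes \<open>512 p\<^sup>2 x (1 - x) / (9 \<beta>\<^sup>2)\<close>, thanks to
  \<open>16 p - q = 9 \<beta>\<^sup>2\<close>. This is the square of a multiple of
  \<open>sin b * cos b\<close>. On the given range \<open>cos b\<close> is nonnegative, and \<sigma>
  restores the sign of \<open>sin b\<close>.\<close>

lemma branch_rate_eq_V_rhs:
  assumes "0 < V" "b \<in> {-pi/2..pi/2}" "0 < dust_density \<beta> \<kappa> V b" "\<sigma> \<in> {1, -1}"
    and "b = branch_angle \<beta> \<kappa> r \<sigma> V (dust_density \<beta> \<kappa> V b)"
  shows "branch_rate \<beta> \<kappa> r \<sigma> V (dust_density \<beta> \<kappa> V b) = V_rhs \<beta> V b"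
proof -
  define x where "x = (sin b)\<^sup>2"
  have D0: "0 \<le> discr \<beta> \<kappa> V (dust_density \<beta> \<kappa> V b)"
    by (simp add: discr_dust_density[OF assms(1)])
  note bs = branch_angle_sin_squared[OF assms(1,3) D0 assms(4,5)]
  have "cos b \<ge> 0" using assms(2) by (auto intro: cos_ge_zero)
  have "q + 4 * p * (8 * G b / (9 * \<beta>\<^sup>2)) - (q - 32 * p * x)
      = 32 * p * x * (9 * \<beta>\<^sup>2 + q - 16 * p * x) / (9 * \<beta>\<^sup>2)"
    using \<beta>_pos by (simp add: G_def x_def[symmetric] field_simps)
  also have "\<dots> = 512 * p\<^sup>2 * x * (1 - x) / (9 * \<beta>\<^sup>2)"
    unfolding pq[symmetric] by (simp add: algebra_simps power2_eq_square)
  also have "\<dots> = (16 * sqrt 2 * p * \<bar>sin b\<bar> * cos b / (3 * \<beta>))\<^sup>2"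
    by (simp add: x_def power_mult_distrib power_divide cos_squared_eq[symmetric])
  finally have "sqrt (q + 4 * p * (8 * G b / (9 * \<beta>\<^sup>2)) - (q - 32 * p * x))
      = 16 * sqrt 2 * p * \<bar>sin b\<bar> * cos b / (3 * \<beta>)"
    using \<open>cos b \<ge> 0\<close> p_pos \<beta>_pos by (simp only:) simp
  then have "branch_rate \<beta> \<kappa> r \<sigma> V (dust_density \<beta> \<kappa> V b)
     = \<sigma> * (V powr (2/3) * (q - 32 * p * x) / (12 * sqrt 2 * p) * (16 * sqrt 2 * p * \<bar>sin b\<bar> * cos b / (3 * \<beta>)))"
    unfolding branch_rate_eq bs(1) dust_density_scaled[OF assms(1)] by (simp add: x_def)
  also have "\<dots> = V powr (2/3) * (q - 32 * p * x) * 4 * (\<sigma> * \<bar>sin b\<bar>) * cos b / (9 * \<beta>)"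
  proof -
    have "\<sigma> * (v * L / (12 * s * p) * (16 * s * p * a * c / (3 * \<beta>))) = v * L * 4 * (\<sigma> * a) * c / (9 * \<beta>)"
      if "s \<noteq> 0" for v L s a c
      using that p_pos by (simp add: field_simps)
    then show ?thesis using p_pos by simp
  qed
  also have "\<dots> = V_rhs \<beta> V b"
    unfolding bs(2)[symmetric] V_rhs_eq powr_two_thirds x_def sin_double by simp
  finally show ?thesis .
qed

lemma on_branchI:
  assumes "effective_solution \<beta> I V b" "\<tau> \<in> I" "0 < dust_density \<beta> \<kappa> (V \<tau>) (b \<tau>)"
    and "b \<tau> \<in> {-pi/2..pi/2}" "\<sigma> \<in> {1, -1}" "\<sigma> * \<bar>sin (b \<tau>)\<bar> = sin (b \<tau>)"
    and "0 \<le> branch_sign r * (q - 32 * p * (sin (b \<tau>))\<^sup>2)"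
  shows "on_branch \<beta> \<kappa> r \<sigma> V b \<tau>"
proof -
  note sol = effective_solutionD[OF assms(1,2)]
  have "b \<tau> = branch_angle \<beta> \<kappa> r \<sigma> (V \<tau>) (dust_density \<beta> \<kappa> (V \<tau>) (b \<tau>))"
    by (rule branch_angle_dust_density[OF sol(1) assms(4,6,7)])
  with branch_rate_eq_V_rhs[OF sol(1) assms(4,3,5) this] sol(2) show ?thesis
    by (simp add: on_branch_def Let_def)
qed

end

section \<open>Low density\<close>

lemma low_density_eventually_pos: "\<forall>\<^sub>F (V, \<rho>) in low_density. 0 < V \<and> 0 < \<rho>"
  by (auto simp: low_density_def eventually_inf_principal intro!: always_eventually)

lemma low_density_filterlim:
  "filterlim (\<lambda>(V, \<rho>). \<rho> * V powr (2/3)) (at_right 0) low_density"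
  by (simp add: low_density_def filterlim_iff_le_filtercomap)

context dust_model
begin

section \<open>Hubble rates on the two branches\<close>

lemma scale_factor_derivative:
  assumes "effective_solution \<beta> I V b" "\<tau> \<in> I" "on_branch \<beta> \<kappa> r \<sigma> V b \<tau>" "0 < c"
  shows "((\<lambda>t. V (t / c) powr (1/3)) has_real_derivative
    hubble \<beta> \<kappa> r \<sigma> (V \<tau>) (dust_density \<beta> \<kappa> (V \<tau>) (b \<tau>)) / c * V \<tau> powr (1/3)) (at (c * \<tau>))"
proof -
  define R where "R = branch_rate \<beta> \<kappa> r \<sigma> (V \<tau>) (dust_density \<beta> \<kappa> (V \<tau>) (b \<tau>))"
  have V: "0 < V \<tau>" by (rule effective_solutionD(1)[OF assms(1,2)])
  have c: "c * \<tau> / c = \<tau>" using assms(4) by simp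
  have "(V has_real_derivative R) (at (c * \<tau> / c))"
    using assms(3) c by (simp add: on_branch_def Let_def R_def)
  then have "((\<lambda>t. V (t / c)) has_real_derivative R * (1 / c)) (at (c * \<tau>))"
    using assms(4) by (intro DERIV_chain2[of V]) (auto intro!: derivative_eq_intros)
  moreover have "((\<lambda>x. x powr (1/3)) has_real_derivative 1 / 3 * V \<tau> powr (1/3 - 1)) (at (V (c * \<tau> / c)))"
    unfolding c by (rule has_real_derivative_powr[OF V])
  ultimately have "((\<lambda>t. V (t / c) powr (1/3)) has_real_derivative
      1 / 3 * V \<tau> powr (1/3 - 1) * (R * (1 / c))) (at (c * \<tau>))"
    by (rule DERIV_chain2[rotated])
  then show ?thesis
    using V powr_diff[of "V \<tau>" "1/3" 1] by (simp add: hubble_def R_def[symmetric] mult_ac)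
qed

lemma hubble_squared:
  assumes "0 < V" "0 < \<rho>" "0 \<le> discr \<beta> \<kappa> V \<rho>" "\<sigma> \<in> {1, -1}"
  shows "(hubble \<beta> \<kappa> r \<sigma> V \<rho>)\<^sup>2 = discr \<beta> \<kappa> V \<rho> *
    (q + 4 * p * (\<kappa> * (\<rho> * V powr (2/3))) - branch_sign r * sqrt (discr \<beta> \<kappa> V \<rho>)) / (2592 * p\<^sup>2 * V powr (2/3))"
proof -
  define u where "u = V powr (1/3)"
  define D where "D = discr \<beta> \<kappa> V \<rho>"
  define B where "B = q + 4 * p * (\<kappa> * (\<rho> * u\<^sup>2)) - branch_sign r * sqrt D"
  have u: "u > 0" using assms(1) by (simp add: u_def)
  have V: "V = u ^ 3" using cube_root_cubed[OF assms(1)] by (simp add: u_def)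
  have w: "V powr (2/3) = u\<^sup>2" by (simp add: powr_two_thirds u_def)
  have "sqrt D \<le> q" "0 \<le> sqrt D"
    using discr_less[OF assms(1,2)] q_pos assms(3) by (auto simp: D_def intro: real_le_lsqrt)
  moreover have "0 \<le> 4 * p * (\<kappa> * (\<rho> * u\<^sup>2))"
    using p_pos \<kappa>_pos assms(2) by simp
  moreover have "branch_sign r * sqrt D \<le> q"
  proof -
    have "- sqrt D \<le> q" using calculation q_pos by linarith
    then show ?thesis using calculation(1) by (cases r) simp_all
  qed
  ultimately have B: "B \<ge> 0"
    unfolding B_def by linarith
  \<comment> \<open>\<open>36 * sqrt 2\<close> is the \<open>12 * sqrt 2\<close> of the rate times
    the \<open>3\<close> of \<open>V' / (3 V)\<close>; its square is \<open>2592\<close>.\<close>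
  have "hubble \<beta> \<kappa> r \<sigma> V \<rho> = \<sigma> * branch_sign r * (sqrt D * sqrt B / (36 * sqrt 2 * p * u))"
    using u p_pos unfolding hubble_def branch_rate_eq mult.assoc[of \<kappa> \<rho>] w D_def[symmetric] B_def[symmetric]
    unfolding V by (simp add: power2_eq_square power3_eq_cube)
  moreover have "(\<sigma> * branch_sign r)\<^sup>2 = 1"
    using assms(4) by (cases r) auto
  ultimately have "(hubble \<beta> \<kappa> r \<sigma> V \<rho>)\<^sup>2 = D * B / (2592 * p\<^sup>2 * u\<^sup>2)"
    using B assms(3) by (simp add: power_mult_distrib power_divide D_def)
  then show ?thesis by (simp add: D_def B_def w)
qed

lemma low_density_scaled: "filterlim (\<lambda>(V, \<rho>). \<kappa> * (\<rho> * V powr (2/3))) (at_right 0) low_density"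
proof -
  have "filterlim (\<lambda>x. \<kappa> * x) (at_right 0) (at_right 0)"
    using \<kappa>_pos by real_asymp
  from filterlim_compose[OF this low_density_filterlim] show ?thesis
    by (simp add: case_prod_unfold)
qed

lemma low_density_eventually:
  "\<forall>\<^sub>F (V, \<rho>) in low_density. 0 < V \<and> 0 < \<rho> \<and> 0 \<le> discr \<beta> \<kappa> V \<rho>"
proof -
  have "\<forall>\<^sub>F K in at_right 0. 0 \<le> q\<^sup>2 - 72 * \<beta>\<^sup>2 * p * K"
  proof (rule order_tendstoD(1)[THEN eventually_mono])
    show "((\<lambda>K. q\<^sup>2 - 72 * \<beta>\<^sup>2 * p * K) \<longlongrightarrow> q\<^sup>2 - 72 * \<beta>\<^sup>2 * p * 0) (at_right 0)"
      by (intro tendsto_intros)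
    show "0 < q\<^sup>2 - 72 * \<beta>\<^sup>2 * p * 0" using q_pos by simp
  qed simp
  from eventually_compose_filterlim[OF this low_density_scaled] low_density_eventually_pos
  show ?thesis
    by eventually_elim (auto simp: discr_alt mult.assoc)
qed

text \<open>The rationalised difference \<open>q - s = (q\<^sup>2 - s\<^sup>2) / (q + s)\<close>
  replaces a Taylor expansion: it is exact, and only the limit \<open>2 q\<close> of the denominator
  is needed afterwards.\<close>

lemma sqrt_discr_expansion:
  assumes "0 < V" "0 < \<rho>" "0 \<le> discr \<beta> \<kappa> V \<rho>"
  shows "sqrt (discr \<beta> \<kappa> V \<rho>) = q - 72 * \<beta>\<^sup>2 * p * (\<kappa> * (\<rho> * V powr (2/3))) / (q + sqrt (discr \<beta> \<kappa> V \<rho>))"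
proof -
  define s where "s = sqrt (discr \<beta> \<kappa> V \<rho>)"
  have s: "s\<^sup>2 = q\<^sup>2 - 72 * \<beta>\<^sup>2 * p * (\<kappa> * (\<rho> * V powr (2/3)))"
    using assms(3) by (simp add: s_def discr_alt mult.assoc)
  have "q + s > 0" using q_pos assms(3) by (simp add: s_def add_pos_nonneg)
  then have "s = q - (q\<^sup>2 - s\<^sup>2) / (q + s)"
    by (simp add: field_simps power2_eq_square)
  then show ?thesis unfolding s by (simp add: s_def)
qed

text \<open>On A the difference \<open>q - sqrt D\<close> is itself of first order in
  \<open>K = \<kappa> * \<rho> * V powr (2/3)\<close>, so no term of order zero, hence no
  \<open>1 / a\<^sup>2\<close>, survives. The quotient by the Friedmann rate is a function
  \<open>\<phi>\<close> of \<open>K\<close> alone, with limit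
  \<open>(9 \<beta>\<^sup>2 + q) / (16 p) = 1\<close>.\<close>

lemma hubble_A_asymp:
  assumes "\<sigma> \<in> {1, -1}"
  shows "(\<lambda>(V, \<rho>). (hubble \<beta> \<kappa> BranchA \<sigma> V \<rho>)\<^sup>2) \<sim>[low_density] (\<lambda>(V, \<rho>). 2 * q / 81 * \<kappa> * \<rho>)"
proof (rule asymp_equivI')
  define a where "a = 72 * \<beta>\<^sup>2 * p"
  define \<phi> where "\<phi> K = (q\<^sup>2 - a * K) * (4 * p + a / (q + sqrt (q\<^sup>2 - a * K))) * 81 / (5184 * p\<^sup>2 * q)" for K
  have "(\<phi> \<longlongrightarrow> (q\<^sup>2 - a * 0) * (4 * p + a / (q + sqrt (q\<^sup>2 - a * 0))) * 81 / (5184 * p\<^sup>2 * q)) (at_right 0)"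
    unfolding \<phi>_def using p_pos q_pos by (intro tendsto_intros) auto
  moreover have "(q\<^sup>2 - a * 0) * (4 * p + a / (q + sqrt (q\<^sup>2 - a * 0))) * 81 / (5184 * p\<^sup>2 * q) = (9 * \<beta>\<^sup>2 + q) / (16 * p)"
    using p_pos q_pos unfolding a_def by (simp add: field_simps power2_eq_square)
  moreover have "(9 * \<beta>\<^sup>2 + q) / (16 * p) = 1"
    using pq p_pos by (simp add: field_simps)
  ultimately have "(\<phi> \<longlongrightarrow> 1) (at_right 0)" by (simp only:)
  from filterlim_compose[OF this low_density_scaled]
  have "((\<lambda>(V, \<rho>). \<phi> (\<kappa> * (\<rho> * V powr (2/3)))) \<longlongrightarrow> 1) low_density"
    by (simp add: case_prod_unfold)
  moreover have "\<forall>\<^sub>F x in low_density. (case x of (V, \<rho>) \<Rightarrow> \<phi> (\<kappa> * (\<rho> * V powr (2/3)))) =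
      (case x of (V, \<rho>) \<Rightarrow> (hubble \<beta> \<kappa> BranchA \<sigma> V \<rho>)\<^sup>2) / (case x of (V, \<rho>) \<Rightarrow> 2 * q / 81 * \<kappa> * \<rho>)"
    using low_density_eventually
  proof eventually_elim
    case (elim x)
    obtain V \<rho> where x: "x = (V, \<rho>)" by (cases x)
    define K where "K = \<kappa> * (\<rho> * V powr (2/3))"
    define D where "D = discr \<beta> \<kappa> V \<rho>"
    have V: "0 < V" "0 < \<rho>" "0 \<le> D" using elim by (auto simp: x D_def)
    have DK: "D = q\<^sup>2 - a * K" by (simp add: D_def a_def K_def discr_alt mult.assoc)
    have K: "K > 0" using V \<kappa>_pos by (simp add: K_def)
    have s: "q - sqrt D = a * K / (q + sqrt D)"
      using sqrt_discr_expansion[of V \<rho>] V by (simp add: D_def a_def K_def)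
    have "(hubble \<beta> \<kappa> BranchA \<sigma> V \<rho>)\<^sup>2 = D * (4 * p * K + (q - sqrt D)) / (2592 * p\<^sup>2 * V powr (2/3))"
      using hubble_squared[of V \<rho> \<sigma> BranchA] V assms by (simp add: D_def K_def algebra_simps)
    also have "\<dots> = D * (4 * p + a / (q + sqrt D)) * K / (2592 * p\<^sup>2 * V powr (2/3))"
      unfolding s by (simp add: algebra_simps)
    finally have H: "(hubble \<beta> \<kappa> BranchA \<sigma> V \<rho>)\<^sup>2 = D * (4 * p + a / (q + sqrt D)) * K / (2592 * p\<^sup>2 * V powr (2/3))" .
    have "(hubble \<beta> \<kappa> BranchA \<sigma> V \<rho>)\<^sup>2 = \<phi> K * (2 * q / 81 * \<kappa> * \<rho>)"
    proof -
      have "D * X * (\<kappa> * (\<rho> * w)) / (2592 * p\<^sup>2 * w) = D * X * 81 / (5184 * p\<^sup>2 * q) * (2 * q / 81 * \<kappa> * \<rho>)"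
        if "w > 0" for X w
        using that p_pos q_pos by (simp add: field_simps)
      from this[of "V powr (2/3)" "4 * p + a / (q + sqrt D)"] show ?thesis
        using V unfolding H \<phi>_def DK[symmetric] by (simp add: K_def)
    qed
    then show ?case
      using V \<kappa>_pos q_pos by (simp add: x K_def)
  qed
  ultimately show "((\<lambda>x. (case x of (V, \<rho>) \<Rightarrow> (hubble \<beta> \<kappa> BranchA \<sigma> V \<rho>)\<^sup>2)
      / (case x of (V, \<rho>) \<Rightarrow> 2 * q / 81 * \<kappa> * \<rho>)) \<longlongrightarrow> 1) low_density"
    by (rule Lim_transform_eventually)
qed

lemma hubble_A_asymp_rescaled:
  obtains c where "0 < c" "\<And>\<sigma>. \<sigma> \<in> {1, -1} \<Longrightarrow>
    (\<lambda>(V, \<rho>). (hubble \<beta> \<kappa> BranchA \<sigma> V \<rho> / c)\<^sup>2) \<sim>[low_density] (\<lambda>(V, \<rho>). \<kappa> * \<rho> / 6)"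
proof
  \<comment> \<open>Chosen so that \<open>2 * q / 81 / c\<^sup>2 = 1 / 6\<close>.\<close>
  define c where "c = sqrt (12 * q / 81)"
  show "0 < c" using q_pos by (simp add: c_def)
  fix \<sigma> :: real assume "\<sigma> \<in> {1, -1}"
  note * = asymp_equiv_mult[OF asymp_equiv_refl[of "\<lambda>_. 1 / c\<^sup>2"] hubble_A_asymp[OF this]]
  have "(\<lambda>x. 1 / c\<^sup>2 * (case x of (V, \<rho>) \<Rightarrow> (hubble \<beta> \<kappa> BranchA \<sigma> V \<rho>)\<^sup>2))
      = (\<lambda>(V, \<rho>). (hubble \<beta> \<kappa> BranchA \<sigma> V \<rho> / c)\<^sup>2)"
    by (auto simp: fun_eq_iff power_divide)
  moreover have "(\<lambda>x. 1 / c\<^sup>2 * (case x of (V, \<rho>) \<Rightarrow> 2 * q / 81 * \<kappa> * \<rho>)) = (\<lambda>(V::real, \<rho>). \<kappa> * \<rho> / 6)"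
    using q_pos by (auto simp: fun_eq_iff c_def)
  ultimately show "(\<lambda>(V, \<rho>). (hubble \<beta> \<kappa> BranchA \<sigma> V \<rho> / c)\<^sup>2) \<sim>[low_density] (\<lambda>(V, \<rho>). \<kappa> * \<rho> / 6)"
    using * by (simp only:)
qed

text \<open>On B the sum \<open>q + sqrt D\<close> tends to \<open>2 q\<close>, which leaves the
  term \<open>2 q ^ 3 / (2592 p\<^sup>2 w)\<close> with \<open>w = V powr (2/3)\<close>. The
  first-order coefficient in \<open>K = \<kappa> \<rho> w\<close> is \<open>4 p q (q - 45
  \<beta>\<^sup>2) = 8 p q (8 - 19 \<beta>\<^sup>2)\<close> over the same denominator, whence the
  \<open>- 19 \<beta>\<^sup>2 + 8\<close>. \<open>\<phi> K\<close> is the remainder divided by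
  \<rho>.\<close>

lemma hubble_B_asymp:
  assumes "\<sigma> \<in> {1, -1}"
  shows "(\<lambda>(V, \<rho>). (hubble \<beta> \<kappa> BranchB \<sigma> V \<rho>)\<^sup>2
            - (q ^ 3 / (1296 * p\<^sup>2 * (V powr (1/3))\<^sup>2)
              + (- 19 * \<beta>\<^sup>2 + 8) * q * \<kappa> * \<rho> / (324 * p)))
          \<in> o[low_density](\<lambda>(V, \<rho>). \<rho>)"
proof (rule smalloI_tendsto)
  define a where "a = 72 * \<beta>\<^sup>2 * p"
  define h where "h K = 1 / (q + sqrt (q\<^sup>2 - a * K))" for K
  define \<phi> where "\<phi> K = \<kappa> * (4 * p * q\<^sup>2 - q\<^sup>2 * a * h K - 2 * q * a - a * K * (4 * p - a * h K)
     - 8 * p * q * (8 - 19 * \<beta>\<^sup>2)) / (2592 * p\<^sup>2)" for K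
  have "(h \<longlongrightarrow> 1 / (q + sqrt (q\<^sup>2 - a * 0))) (at_right 0)"
    unfolding h_def using q_pos by (intro tendsto_intros) auto
  then have h: "(h \<longlongrightarrow> 1 / (2 * q)) (at_right 0)" using q_pos by simp
  have "(\<phi> \<longlongrightarrow> \<kappa> * (4 * p * q\<^sup>2 - q\<^sup>2 * a * (1 / (2 * q)) - 2 * q * a - a * 0 * (4 * p - a * (1 / (2 * q)))
     - 8 * p * q * (8 - 19 * \<beta>\<^sup>2)) / (2592 * p\<^sup>2)) (at_right 0)"
    unfolding \<phi>_def using p_pos by (intro tendsto_intros h) auto
  moreover have "4 * p * q\<^sup>2 - q\<^sup>2 * a * (1 / (2 * q)) - 2 * q * a - a * 0 * (4 * p - a * (1 / (2 * q)))
     - 8 * p * q * (8 - 19 * \<beta>\<^sup>2) = 4 * p * q * (q - 7 * \<beta>\<^sup>2 - 16)"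
    using q_pos by (simp add: a_def field_simps power2_eq_square)
  ultimately have "(\<phi> \<longlongrightarrow> 0) (at_right 0)" by (simp add: q_def)
  from filterlim_compose[OF this low_density_scaled]
  have "((\<lambda>(V, \<rho>). \<phi> (\<kappa> * (\<rho> * V powr (2/3)))) \<longlongrightarrow> 0) low_density"
    by (simp add: case_prod_unfold)
  moreover have "\<forall>\<^sub>F x in low_density. (case x of (V, \<rho>) \<Rightarrow> \<phi> (\<kappa> * (\<rho> * V powr (2/3)))) =
      (case x of (V, \<rho>) \<Rightarrow> (hubble \<beta> \<kappa> BranchB \<sigma> V \<rho>)\<^sup>2
            - (q ^ 3 / (1296 * p\<^sup>2 * (V powr (1/3))\<^sup>2)
              + (- 19 * \<beta>\<^sup>2 + 8) * q * \<kappa> * \<rho> / (324 * p))) / (case x of (V, \<rho>) \<Rightarrow> \<rho>)"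
    using low_density_eventually
  proof eventually_elim
    case (elim x)
    obtain V \<rho> where x: "x = (V, \<rho>)" by (cases x)
    define w where "w = V powr (2/3)"
    define K where "K = \<kappa> * (\<rho> * w)"
    define D where "D = discr \<beta> \<kappa> V \<rho>"
    have V: "0 < V" "0 < \<rho>" "0 \<le> D" using elim by (auto simp: x D_def)
    have w: "w > 0" using V by (simp add: w_def)
    have DK: "D = q\<^sup>2 - a * K" by (simp add: D_def a_def K_def w_def discr_alt mult.assoc)
    have s: "sqrt D = q - a * K * h K"
      using sqrt_discr_expansion[of V \<rho>] V by (simp add: h_def DK[symmetric]) (simp add: D_def a_def K_def w_def)
    have "(hubble \<beta> \<kappa> BranchB \<sigma> V \<rho>)\<^sup>2 = D * (q + 4 * p * K + sqrt D) / (2592 * p\<^sup>2 * w)"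
      using hubble_squared[of V \<rho> \<sigma> BranchB] V assms by (simp add: D_def K_def w_def)
    also have "\<dots> = (q\<^sup>2 - a * K) * (q + 4 * p * K + (q - a * K * h K)) / (2592 * p\<^sup>2 * w)"
      unfolding s by (simp add: DK)
    also have "\<dots> = (2 * q ^ 3 + K * (4 * p * q\<^sup>2 - q\<^sup>2 * a * h K - 2 * q * a - a * K * (4 * p - a * h K))) / (2592 * p\<^sup>2 * w)"
      by (simp add: algebra_simps power2_eq_square power3_eq_cube)
    finally have H: "(hubble \<beta> \<kappa> BranchB \<sigma> V \<rho>)\<^sup>2
       = q ^ 3 / (1296 * p\<^sup>2 * w) + \<rho> * \<kappa> * (4 * p * q\<^sup>2 - q\<^sup>2 * a * h K - 2 * q * a - a * K * (4 * p - a * h K)) / (2592 * p\<^sup>2)"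
      using w p_pos by (simp add: K_def add_divide_distrib mult_ac)
    have "(hubble \<beta> \<kappa> BranchB \<sigma> V \<rho>)\<^sup>2
       - (q ^ 3 / (1296 * p\<^sup>2 * w) + (- 19 * \<beta>\<^sup>2 + 8) * q * \<kappa> * \<rho> / (324 * p)) = \<phi> K * \<rho>"
      unfolding H \<phi>_def using p_pos by (simp add: field_simps power2_eq_square)
    then show ?case
      using V by (simp add: x K_def w_def powr_two_thirds)
  qed
  ultimately show "((\<lambda>x. (case x of (V, \<rho>) \<Rightarrow> (hubble \<beta> \<kappa> BranchB \<sigma> V \<rho>)\<^sup>2
            - (q ^ 3 / (1296 * p\<^sup>2 * (V powr (1/3))\<^sup>2)
              + (- 19 * \<beta>\<^sup>2 + 8) * q * \<kappa> * \<rho> / (324 * p))) / (case x of (V, \<rho>) \<Rightarrow> \<rho>)) \<longlongrightarrow> 0) low_density"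
    by (rule Lim_transform_eventually)
  show "\<forall>\<^sub>F x in low_density. (case x of (V, \<rho>) \<Rightarrow> \<rho>) \<noteq> (0::real)"
    using low_density_eventually_pos by eventually_elim auto
qed


section \<open>The global flow\<close>

definition m :: real where "m = 3 * \<beta> / sqrt q"

lemma m_pos: "0 < m"
  using \<beta>_pos q_pos by (simp add: m_def)

lemma q_m_squared: "q * m\<^sup>2 = 9 * \<beta>\<^sup>2"
  using q_pos by (simp add: m_def power_divide power_mult_distrib)

text \<open>
  In the cotangent \<open>c\<close> of the holonomy angle, \<open>(sin b)\<^sup>2 = 1 / (1 + c\<^sup>2)\<close>, and \<open>m\<close> is where the energy
  vanishes.
\<close>

lemma G_cot:
  assumes "(sin b)\<^sup>2 = 1 / (1 + c\<^sup>2)"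
  shows "G b = q * (c\<^sup>2 - m\<^sup>2) / (1 + c\<^sup>2)\<^sup>2"
proof -
  have c: "1 + c\<^sup>2 > 0" by (simp add: add_pos_nonneg)
  have "G b = (q * (1 + c\<^sup>2) - 16 * p) / (1 + c\<^sup>2)\<^sup>2"
    using c unfolding G_def assms by (simp add: field_simps power2_eq_square)
  also have "q * (1 + c\<^sup>2) - 16 * p = q * (c\<^sup>2 - m\<^sup>2)"
    using pq by (simp add: algebra_simps q_m_squared)
  finally show ?thesis .
qed

text \<open>The inverse cotangent in the first quadrant, \<open>cot_flow m s\<close> being
  positive.\<close>

definition angle_flow :: "real \<Rightarrow> real" where
  "angle_flow s = arctan (1 / cot_flow m s)"

lemma angle_flow:
  shows angle_flow_pos: "0 < angle_flow s"
    and angle_flow_less: "angle_flow s < pi / 2"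
    and sin_angle_flow: "(sin (angle_flow s))\<^sup>2 = 1 / (1 + (cot_flow m s)\<^sup>2)"
    and cos_angle_flow: "cos (angle_flow s) = cot_flow m s * sin (angle_flow s)"
proof -
  define c where "c = cot_flow m s"
  have c: "0 < c" using cot_flow_gt[OF m_pos, of s] m_pos by (simp add: c_def)
  show "0 < angle_flow s" using c by (simp add: angle_flow_def c_def)
  show "angle_flow s < pi / 2" unfolding angle_flow_def by (rule arctan_ubound)
  have "cos (angle_flow s) \<noteq> 0" by (simp add: angle_flow_def)
  moreover have "tan (angle_flow s) = 1 / c" by (simp add: angle_flow_def tan_arctan c_def)
  ultimately have *: "cos (angle_flow s) = c * sin (angle_flow s)"
    using c by (simp add: tan_def field_simps)
  then show "cos (angle_flow s) = cot_flow m s * sin (angle_flow s)" by (simp add: c_def)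
  have "(1 + c\<^sup>2) * (sin (angle_flow s))\<^sup>2 = 1"
    using sin_cos_squared_add[of "angle_flow s"] unfolding * by (simp add: algebra_simps power_mult_distrib)
  moreover have "1 + c\<^sup>2 > 0" by (simp add: add_pos_nonneg)
  ultimately show "(sin (angle_flow s))\<^sup>2 = 1 / (1 + (cot_flow m s)\<^sup>2)"
    by (simp add: field_simps c_def)
qed

lemma G_angle_flow: "G (angle_flow s) = q * ((cot_flow m s)\<^sup>2 - m\<^sup>2) / (1 + (cot_flow m s)\<^sup>2)\<^sup>2"
  by (rule G_cot[OF sin_angle_flow])

lemma G_angle_flow_pos: "0 < G (angle_flow s)"
proof -
  have "m\<^sup>2 < (cot_flow m s)\<^sup>2"
    using cot_flow_gt[OF m_pos, of s] m_pos by (simp add: power_strict_mono)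
  moreover have "0 < (1 + (cot_flow m s)\<^sup>2)" by (simp add: add_pos_nonneg)
  ultimately show ?thesis
    using q_pos by (simp add: G_angle_flow)
qed

lemma angle_flow_derivative:
  "(angle_flow has_real_derivative - ((G (angle_flow s))\<^sup>2 / q\<^sup>2)) (at s)"
proof -
  define c where "c = cot_flow m s"
  have c: "0 < c" using cot_flow_gt[OF m_pos, of s] m_pos by (simp add: c_def)
  have c1: "1 + c\<^sup>2 > 0" by (simp add: add_pos_nonneg)
  have "((\<lambda>s. arctan (1 / cot_flow m s)) has_real_derivative
      inverse (1 + (1 / c)\<^sup>2) * (- ((c\<^sup>2 - m\<^sup>2)\<^sup>2 / (1 + c\<^sup>2) ^ 3) / (c * c))) (at s)"
    using c cot_flow_derivative[OF m_pos, of s]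
    by (auto intro!: derivative_eq_intros simp: c_def)
  moreover have "inverse (1 + (1 / c)\<^sup>2) * (- ((c\<^sup>2 - m\<^sup>2)\<^sup>2 / (1 + c\<^sup>2) ^ 3) / (c * c))
      = - ((q * (c\<^sup>2 - m\<^sup>2) / (1 + c\<^sup>2)\<^sup>2)\<^sup>2 / q\<^sup>2)"
  proof -
    have "inverse (1 + (1 / c)\<^sup>2) = c * c / (1 + c\<^sup>2)"
      using c by (simp add: field_simps power2_eq_square)
    then show ?thesis
      using c c1 q_pos by (simp add: power_mult_distrib power_divide power2_eq_square power3_eq_cube)
  qed
  ultimately have "((\<lambda>s. arctan (1 / cot_flow m s)) has_real_derivative - ((G (angle_flow s))\<^sup>2 / q\<^sup>2)) (at s)"
    by (simp only: G_angle_flow c_def)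
  then show ?thesis by (simp only: angle_flow_def[abs_def])
qed

section \<open>Solutions of given energy, built from and reduced to the flow\<close>

definition flow_rate :: "real \<Rightarrow> real" where
  "flow_rate E = 16 * q\<^sup>2 / (243 * \<beta> ^ 3 * \<kappa> * E)"

text \<open>The energy equation solved for \<open>V\<close>. Inserting the resulting
  \<open>V powr (1/3)\<close> into \<open>b_rhs\<close> gives
  \<open>- flow_rate E * (G b)\<^sup>2 / q\<^sup>2\<close>: the constant in \<open>flow_rate\<close>
  is the speed of the clock in dust time.\<close>

definition flow_volume :: "real \<Rightarrow> real \<Rightarrow> real" where
  "flow_volume E s = (9 * \<beta>\<^sup>2 * \<kappa> * E / (8 * G (angle_flow s))) ^ 3"

lemma flow_rate_pos: "0 < E \<Longrightarrow> 0 < flow_rate E"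
  using \<beta>_pos \<kappa>_pos q_pos by (simp add: flow_rate_def)

text \<open>The symmetries of the model: here \<open>a\<close> is a multiple of \<open>pi\<close>,
  and shifting or reflecting the angle changes \<open>(sin b)\<^sup>2\<close> and the energy not at
  all. Only the sign of \<open>sin (2 b)\<close>, and with it that of \<open>V'\<close>, sees
  \<sigma>.\<close>

lemma
  assumes "sin a = 0" "\<sigma> \<in> {1, -1}"
  shows sin_shift_squared: "(sin (a + \<sigma> * x))\<^sup>2 = (sin x)\<^sup>2"
    and G_shift: "G (a + \<sigma> * x) = G x"
    and sin_double_shift: "sin (2 * (a + \<sigma> * x)) = \<sigma> * sin (2 * x)"
proof -
  have "(cos a)\<^sup>2 = 1" using assms(1) by (simp add: cos_squared_eq)
  then show *: "(sin (a + \<sigma> * x))\<^sup>2 = (sin x)\<^sup>2"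
    using assms by (auto simp: sin_add power_mult_distrib)
  show "G (a + \<sigma> * x) = G x" by (simp add: G_def *)
  have "sin (2 * a) = 0" "cos (2 * a) = 1"
    using assms(1) by (simp_all add: sin_double cos_double_sin)
  then show "sin (2 * (a + \<sigma> * x)) = \<sigma> * sin (2 * x)"
    using assms(2) by (auto simp: distrib_left sin_add)
qed

text \<open>The sign \<sigma> occurs both in front of the angle and in the direction of time, so it
  cancels in \<open>b'\<close>. The volume equation is then the derivative of
  \<open>V = (N / G b) ^ 3\<close>, since its right-hand side contains the derivative of
  \<open>G\<close>.\<close>

lemma flow_solution:
  fixes d :: real
  assumes "0 < E" "sin a = 0" "\<sigma> \<in> {1, -1}"
  defines "V \<equiv> (\<lambda>\<tau>. flow_volume E (\<sigma> * flow_rate E * \<tau> + d))"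
    and "b \<equiv> (\<lambda>\<tau>. a + \<sigma> * angle_flow (\<sigma> * flow_rate E * \<tau> + d))"
  shows "effective_solution \<beta> UNIV V b" "energy \<beta> \<kappa> (V \<tau>) (b \<tau>) = E"
    "0 < dust_density \<beta> \<kappa> (V \<tau>) (b \<tau>)"
proof -
  define N where "N = 9 * \<beta>\<^sup>2 * \<kappa> * E / 8"
  have N: "N > 0" using assms(1) \<beta>_pos \<kappa>_pos by (simp add: N_def)
  have Gb: "G (b \<tau>) = G (angle_flow (\<sigma> * flow_rate E * \<tau> + d))" for \<tau>
    unfolding b_def by (rule G_shift[OF assms(2,3)])
  then have Gpos: "G (b \<tau>) > 0" for \<tau> by (simp add: G_angle_flow_pos)
  have V: "V \<tau> = (N / G (b \<tau>)) ^ 3" for \<tau>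
    by (simp add: V_def flow_volume_def Gb N_def)
  have Vpos: "V \<tau> > 0" for \<tau> using N Gpos by (simp add: V)
  have u: "V \<tau> powr (1/3) = N / G (b \<tau>)" for \<tau>
    unfolding V by (rule cubed_cube_root) (simp add: N Gpos)
  show E: "energy \<beta> \<kappa> (V \<tau>) (b \<tau>) = E"
    using Gpos[of \<tau>] \<beta>_pos \<kappa>_pos by (simp add: energy_eq u N_def)
  show "0 < dust_density \<beta> \<kappa> (V \<tau>) (b \<tau>)"
    using Gpos Vpos by (simp add: dust_density_pos_iff)
  have db: "(b has_real_derivative - (2 * (G (b \<tau>))\<^sup>2 / (27 * \<beta> * N))) (at \<tau>)" for \<tau>
  proof -
    have "(b has_real_derivative \<sigma> * (- ((G (b \<tau>))\<^sup>2 / q\<^sup>2) * (\<sigma> * flow_rate E))) (at \<tau>)"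
      unfolding Gb unfolding b_def
      by (auto intro!: derivative_eq_intros DERIV_chain2[OF angle_flow_derivative])
    moreover have "flow_rate E = q\<^sup>2 * (2 / (27 * \<beta> * N))"
      using \<beta>_pos \<kappa>_pos assms(1)
      by (simp add: flow_rate_def N_def power2_eq_square power3_eq_cube)
    then have "\<sigma> * (- ((G (b \<tau>))\<^sup>2 / q\<^sup>2) * (\<sigma> * flow_rate E)) = - (2 * (G (b \<tau>))\<^sup>2 / (27 * \<beta> * N))"
      using assms(3) q_pos by auto
    ultimately show ?thesis by (simp only:)
  qed
  have dG: "((\<lambda>t. G (b t)) has_real_derivative
      sin (2 * b \<tau>) * (q - 32 * p * (sin (b \<tau>))\<^sup>2) * - (2 * (G (b \<tau>))\<^sup>2 / (27 * \<beta> * N))) (at \<tau>)" for \<tau>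
    by (rule DERIV_chain2[OF G_derivative db])
  have dV: "(V has_real_derivative V_rhs \<beta> (V \<tau>) (b \<tau>)) (at \<tau>)" for \<tau>
  proof -
    define S where "S = sin (2 * b \<tau>) * (q - 32 * p * (sin (b \<tau>))\<^sup>2)"
    have "((\<lambda>t. (N / G (b t)) ^ 3) has_real_derivative
       3 * (N / G (b \<tau>))\<^sup>2 * (- (N * (S * - (2 * (G (b \<tau>))\<^sup>2 / (27 * \<beta> * N)))) / (G (b \<tau>) * G (b \<tau>)))) (at \<tau>)"
      using Gpos[of \<tau>] dG[of \<tau>] by (auto intro!: derivative_eq_intros simp: S_def)
    moreover have "3 * (N / G (b \<tau>))\<^sup>2 * (- (N * (S * - (2 * (G (b \<tau>))\<^sup>2 / (27 * \<beta> * N)))) / (G (b \<tau>) * G (b \<tau>)))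
        = 2 * (N / G (b \<tau>))\<^sup>2 * S / (9 * \<beta>)"
      using Gpos[of \<tau>] N \<beta>_pos by (simp add: field_simps power2_eq_square)
    ultimately show ?thesis
      by (simp add: V[abs_def] V_rhs_eq u[unfolded V] S_def mult.assoc)
  qed
  show "effective_solution \<beta> UNIV V b"
    unfolding effective_solution_def
    using Vpos dV db by (auto simp: b_rhs_eq u power2_eq_square mult.assoc)
qed

text \<open>Energy conservation eliminates \<open>V\<close> and leaves an autonomous equation for
  the cotangent \<open>c\<close> of \<open>b\<close>, to which \<open>cot_flow_unique\<close>
  applies once the sign of \<open>c\<close> is known. The constants are the energy \<open>E\<close>,
  the sign \<sigma> of \<open>c\<close>, the time shift \<open>d\<close> and the multiple
  \<open>a\<close> of \<open>pi\<close> that the cotangent does not see.\<close>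

lemma solution_is_flow:
  assumes sol: "effective_solution \<beta> I V b" and pos: "\<And>\<tau>. \<tau> \<in> I \<Longrightarrow> 0 < dust_density \<beta> \<kappa> (V \<tau>) (b \<tau>)"
  obtains E \<sigma> a d where "0 < E" "\<sigma> \<in> {1, -1}" "sin a = 0"
    "\<And>\<tau>. \<tau> \<in> I \<Longrightarrow> V \<tau> = flow_volume E (\<sigma> * flow_rate E * \<tau> + d)"
    "\<And>\<tau>. \<tau> \<in> I \<Longrightarrow> b \<tau> = a + \<sigma> * angle_flow (\<sigma> * flow_rate E * \<tau> + d)"
proof -
  have I: "convex I" "connected I" "I \<noteq> {}"
    using sol by (auto simp: effective_solution_def is_interval_convex_1 is_interval_connected)
  then obtain \<tau>0 where \<tau>0: "\<tau>0 \<in> I" by blast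
  note solD = effective_solutionD[OF sol]
  obtain E where E: "\<And>\<tau>. \<tau> \<in> I \<Longrightarrow> energy \<beta> \<kappa> (V \<tau>) (b \<tau>) = E"
    by (rule energy_conserved[OF sol]) blast
  have Epos: "0 < E"
    using pos[OF \<tau>0] solD(1)[OF \<tau>0] E[OF \<tau>0] by (simp add: dust_density_def zero_less_divide_iff)
  have Gpos: "0 < G (b \<tau>)" if "\<tau> \<in> I" for \<tau>
    using pos[OF that] solD(1)[OF that] by (simp add: dust_density_pos_iff)
  have u: "V \<tau> powr (1/3) = 9 * \<beta>\<^sup>2 * \<kappa> * E / (8 * G (b \<tau>))" if "\<tau> \<in> I" for \<tau>
    using E[OF that] Gpos[OF that] \<beta>_pos \<kappa>_pos by (simp add: energy_eq field_simps)
  define \<Lambda> where "\<Lambda> = flow_rate E"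
  have db: "(b has_real_derivative - (\<Lambda> * ((G (b \<tau>))\<^sup>2 / q\<^sup>2))) (at \<tau>)" if "\<tau> \<in> I" for \<tau>
  proof -
    have "b_rhs \<beta> (V \<tau>) (b \<tau>) = - (\<Lambda> * ((G (b \<tau>))\<^sup>2 / q\<^sup>2))"
      using Gpos[OF that] \<beta>_pos \<kappa>_pos q_pos Epos unfolding b_rhs_eq u[OF that] \<Lambda>_def flow_rate_def
      by (simp add: field_simps power2_eq_square power3_eq_cube)
    then show ?thesis using solD(3)[OF that] by simp
  qed
  define c where "c \<tau> = cos (b \<tau>) / sin (b \<tau>)" for \<tau>
  have s0: "sin (b \<tau>) \<noteq> 0" if "\<tau> \<in> I" for \<tau>
    using Gpos[OF that] by (auto simp: G_def)
  have sc: "(sin (b \<tau>))\<^sup>2 = 1 / (1 + (c \<tau>)\<^sup>2)" if "\<tau> \<in> I" for \<tau>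
    using s0[OF that] sin_cos_squared_add[of "b \<tau>"] unfolding c_def by (simp add: field_simps power_divide)
  have c1: "0 < 1 + (c \<tau>)\<^sup>2" for \<tau> by (simp add: add_pos_nonneg)
  have cm: "m < \<bar>c \<tau>\<bar>" if "\<tau> \<in> I" for \<tau>
  proof -
    have "0 < (c \<tau>)\<^sup>2 - m\<^sup>2"
      using Gpos[OF that] c1[of \<tau>] q_pos unfolding G_cot[OF sc[OF that]]
      by (simp add: zero_less_divide_iff zero_less_mult_iff)
    then have "m\<^sup>2 < \<bar>c \<tau>\<bar>\<^sup>2" by simp
    then show ?thesis by (rule power_less_imp_less_base) simp
  qed
  have dc: "(c has_real_derivative \<Lambda> * (((c \<tau>)\<^sup>2 - m\<^sup>2)\<^sup>2 / (1 + (c \<tau>)\<^sup>2) ^ 3)) (at \<tau>)" if "\<tau> \<in> I" for \<tau>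
  proof -
    have "- (sin (b \<tau>) * sin (b \<tau>)) - cos (b \<tau>) * cos (b \<tau>) = - 1"
      using sin_cos_squared_add3[of "b \<tau>"] by linarith
    then have "((\<lambda>x. cos x / sin x) has_real_derivative - (1 / (sin (b \<tau>))\<^sup>2)) (at (b \<tau>))"
      using s0[OF that] by (auto intro!: derivative_eq_intros simp: power2_eq_square)
    from DERIV_chain2[OF this db[OF that]]
    have "(c has_real_derivative - (1 / (sin (b \<tau>))\<^sup>2) * - (\<Lambda> * ((G (b \<tau>))\<^sup>2 / q\<^sup>2))) (at \<tau>)"
      by (simp add: c_def[abs_def])
    moreover have "- (1 / (sin (b \<tau>))\<^sup>2) * - (\<Lambda> * ((G (b \<tau>))\<^sup>2 / q\<^sup>2)) = \<Lambda> * (((c \<tau>)\<^sup>2 - m\<^sup>2)\<^sup>2 / (1 + (c \<tau>)\<^sup>2) ^ 3)"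
    proof -
      have "- (1 / (1 / k)) * - (\<Lambda> * ((q * w / k\<^sup>2)\<^sup>2 / q\<^sup>2)) = \<Lambda> * (w\<^sup>2 / k ^ 3)" if "0 < k" for k w
        using that q_pos by (simp add: power_mult_distrib power_divide power2_eq_square power3_eq_cube)
      from this[OF c1] show ?thesis
        unfolding G_cot[OF sc[OF that]] sc[OF that] .
    qed
    ultimately show ?thesis by simp
  qed
  define \<sigma> where "\<sigma> = sgn (c \<tau>0)"
  have "c \<tau>0 \<noteq> 0" using cm[OF \<tau>0] m_pos by auto
  then have \<sigma>: "\<sigma> \<in> {1, -1}" by (auto simp: \<sigma>_def sgn_if)
  \<comment> \<open>Positive density keeps \<open>|c|\<close> above \<open>m\<close>, so on an
    interval the continuous \<open>c\<close> cannot change sign.\<close>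
  have conn: "connected (c ` I)"
    using dc by (intro connected_continuous_image I continuous_at_imp_continuous_on)
       (auto intro: DERIV_isCont)
  have "0 \<notin> c ` I" using cm m_pos by force
  then have same: "0 < c \<tau>0 \<longleftrightarrow> 0 < c \<tau>" if "\<tau> \<in> I" for \<tau>
    using connectedD_interval[OF conn imageI[OF that] imageI[OF \<tau>0], of 0]
      connectedD_interval[OF conn imageI[OF \<tau>0] imageI[OF that], of 0]
    by (meson linorder_not_less nless_le)
  have \<sigma>c: "\<sigma> * c \<tau> = \<bar>c \<tau>\<bar>" if "\<tau> \<in> I" for \<tau>
    using same[OF that] \<open>c \<tau>0 \<noteq> 0\<close> cm[OF that] m_pos by (auto simp: \<sigma>_def sgn_if)
  have \<sigma>2: "\<sigma> * \<sigma> = 1" "\<sigma>\<^sup>2 = 1" using \<sigma> by auto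
  obtain d where d: "\<And>\<tau>. \<tau> \<in> I \<Longrightarrow> \<sigma> * c \<tau> = cot_flow m (\<sigma> * \<Lambda> * \<tau> + d)"
  proof (rule cot_flow_unique[OF m_pos I(1), of "\<lambda>\<tau>. \<sigma> * c \<tau>" "\<sigma> * \<Lambda>"])
    fix \<tau> assume \<tau>: "\<tau> \<in> I"
    show "m < \<sigma> * c \<tau>" using cm[OF \<tau>] \<sigma>c[OF \<tau>] by simp
    show "((\<lambda>\<tau>. \<sigma> * c \<tau>) has_real_derivative
       \<sigma> * \<Lambda> * (((\<sigma> * c \<tau>)\<^sup>2 - m\<^sup>2)\<^sup>2 / (1 + (\<sigma> * c \<tau>)\<^sup>2) ^ 3)) (at \<tau>)"
      using DERIV_cmult[OF dc[OF \<tau>], of \<sigma>] by (simp add: power_mult_distrib \<sigma>2 mult.assoc)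
  qed blast
  let ?a = "\<lambda>\<tau>. angle_flow (\<sigma> * \<Lambda> * \<tau> + d)"
  have sin_a: "(sin (?a \<tau>))\<^sup>2 = (sin (b \<tau>))\<^sup>2" if "\<tau> \<in> I" for \<tau>
    unfolding sin_angle_flow sc[OF that] d[OF that, symmetric] by (simp add: power_mult_distrib \<sigma>2)
  then have G_a: "G (?a \<tau>) = G (b \<tau>)" if "\<tau> \<in> I" for \<tau>
    using that by (simp add: G_def)
  \<comment> \<open>Equal cotangents determine the angle only modulo \<open>pi\<close> at each time;
    comparing derivatives makes the offset the same at all times.\<close>
  have "\<exists>a. \<forall>\<tau>\<in>I. b \<tau> - \<sigma> * ?a \<tau> = a"
  proof (rule has_field_derivative_zero_constant[OF I(1)])
    fix \<tau> assume \<tau>: "\<tau> \<in> I"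
    have "((\<lambda>\<tau>. ?a \<tau>) has_real_derivative - ((G (b \<tau>))\<^sup>2 / q\<^sup>2) * (\<sigma> * \<Lambda>)) (at \<tau>)"
      unfolding G_a[OF \<tau>, symmetric]
      by (rule DERIV_chain2[OF angle_flow_derivative]) (auto intro!: derivative_eq_intros)
    from DERIV_diff[OF db[OF \<tau>] DERIV_cmult[OF this, of \<sigma>]]
    have "((\<lambda>\<tau>. b \<tau> - \<sigma> * ?a \<tau>) has_real_derivative
      - (\<Lambda> * ((G (b \<tau>))\<^sup>2 / q\<^sup>2)) - \<sigma> * (- ((G (b \<tau>))\<^sup>2 / q\<^sup>2) * (\<sigma> * \<Lambda>))) (at \<tau>)" .
    moreover have "- (\<Lambda> * ((G (b \<tau>))\<^sup>2 / q\<^sup>2)) - \<sigma> * (- ((G (b \<tau>))\<^sup>2 / q\<^sup>2) * (\<sigma> * \<Lambda>)) = 0"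
      using \<sigma> by auto
    ultimately show "((\<lambda>\<tau>. b \<tau> - \<sigma> * ?a \<tau>) has_real_derivative 0) (at \<tau> within I)"
      by (simp only: has_field_derivative_at_within)
  qed
  then obtain a where a: "\<And>\<tau>. \<tau> \<in> I \<Longrightarrow> b \<tau> - \<sigma> * ?a \<tau> = a" by blast
  have "sin a = 0"
  proof -
    have "sin (\<sigma> * ?a \<tau>0) = \<sigma> * sin (?a \<tau>0)" "cos (\<sigma> * ?a \<tau>0) = cos (?a \<tau>0)"
      using \<sigma> by auto
    \<comment> \<open>\<open>a\<close> is the difference of two angles with the same
      cotangent.\<close>
    then have "sin a = sin (b \<tau>0) * cos (?a \<tau>0) - cos (b \<tau>0) * (\<sigma> * sin (?a \<tau>0))"
      by (simp add: a[OF \<tau>0, symmetric] sin_diff)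
    also have "cos (?a \<tau>0) = \<sigma> * c \<tau>0 * sin (?a \<tau>0)"
      by (simp add: cos_angle_flow d[OF \<tau>0])
    also have "cos (b \<tau>0) = c \<tau>0 * sin (b \<tau>0)"
      using s0[OF \<tau>0] by (simp add: c_def)
    finally show ?thesis by (simp add: algebra_simps)
  qed
  show ?thesis
  proof
    fix \<tau> assume \<tau>: "\<tau> \<in> I"
    show "b \<tau> = a + \<sigma> * angle_flow (\<sigma> * flow_rate E * \<tau> + d)"
      using a[OF \<tau>] by (simp add: \<Lambda>_def)
    have "V \<tau> = (V \<tau> powr (1/3)) ^ 3" using cube_root_cubed[OF solD(1)[OF \<tau>]] by simp
    then show "V \<tau> = flow_volume E (\<sigma> * flow_rate E * \<tau> + d)"
      using G_a[OF \<tau>] by (simp add: u[OF \<tau>] flow_volume_def \<Lambda>_def)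
  qed fact+
qed

end

section \<open>The bounce\<close>

text \<open>The derivative is tested on the open half-line because it vanishes at the bounce, which
  is the endpoint.\<close>

lemma strict_mono_on_atLeastI:
  fixes f :: "real \<Rightarrow> real"
  assumes "\<And>x. isCont f x" "\<And>x. t < x \<Longrightarrow> \<exists>y. (f has_real_derivative y) (at x) \<and> 0 < y"
  shows "strict_mono_on {t..} f"
proof (rule strict_mono_onI)
  fix x y assume "x \<in> {t..}" "y \<in> {t..}" "x < y"
  then show "f x < f y"
    using assms by (intro DERIV_pos_imp_increasing_open[of x y f] continuous_at_imp_continuous_on) auto
qed

lemma strict_antimono_on_atMostI:
  fixes f :: "real \<Rightarrow> real"
  assumes "\<And>x. isCont f x" "\<And>x. x < t \<Longrightarrow> \<exists>y. (f has_real_derivative y) (at x) \<and> y < 0"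
  shows "strict_antimono_on {..t} f"
proof (rule monotone_onI)
  fix x y assume "x \<in> {..t}" "y \<in> {..t}" "x < y"
  then show "f x > f y"
    using assms by (intro DERIV_neg_imp_decreasing_open[of x y f] continuous_at_imp_continuous_on) auto
qed

context dust_model
begin

text \<open>The clock time at which \<open>G\<close> is maximal:
  \<open>(sin b)\<^sup>2 = q / (32 p)\<close> means \<open>1 + c\<^sup>2 = 32 p / q\<close>.\<close>

definition critical_clock :: real where
  "critical_clock = clock m (sqrt ((32 * p - q) / q))"

text \<open>\<open>q - 32 p / (1 + c\<^sup>2)\<close> has the sign of \<open>c - r\<close>, with
  \<open>r\<close> the critical cotangent, and \<open>c\<close> increases along the flow.\<close>

lemma sgn_slope_flow:
  "sgn (q - 32 * p * (sin (angle_flow s))\<^sup>2) = sgn (s - critical_clock)"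
proof -
  define r where "r = sqrt ((32 * p - q) / q)"
  define c where "c = cot_flow m s"
  have "0 < (32 * p - q) / q" using q_less p_pos q_pos by simp
  then have r: "0 < r" "q * r\<^sup>2 = 32 * p - q" using q_pos by (auto simp: r_def)
  \<comment> \<open>The difference of the two sides is \<open>16 * p\<close>.\<close>
  have "q * m\<^sup>2 < q * r\<^sup>2" using pq p_pos by (simp add: q_m_squared r(2))
  then have "m < r" using r(1) q_pos by (auto intro: power_less_imp_less_base)
  then have cr: "cot_flow m critical_clock = r"
    by (simp add: critical_clock_def r_def[symmetric] cot_flow_clock[OF m_pos])
  have c: "0 < c" using cot_flow_gt[OF m_pos, of s] m_pos by (simp add: c_def)
  have c1: "0 < 1 + c\<^sup>2" by (simp add: add_pos_nonneg)
  have "q - 32 * p * (sin (angle_flow s))\<^sup>2 = (q * (1 + c\<^sup>2) - 32 * p) / (1 + c\<^sup>2)"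
    using c1 by (simp add: sin_angle_flow c_def[symmetric] field_simps)
  also have "q * (1 + c\<^sup>2) - 32 * p = q * (c + r) * (c - r)"
    using r(2) by (simp add: algebra_simps power2_eq_square)
  finally have "q - 32 * p * (sin (angle_flow s))\<^sup>2 = q * (c + r) * (c - r) / (1 + c\<^sup>2)" .
  then have "sgn (q - 32 * p * (sin (angle_flow s))\<^sup>2) = sgn (c - r)"
    using c c1 r(1) q_pos by (simp add: sgn_mult sgn_divide)
  also have "\<dots> = sgn (s - critical_clock)"
  proof (cases s critical_clock rule: linorder_cases)
    case less
    then have "c < r" using cot_flow_strict_mono[OF m_pos] by (simp add: c_def cr[symmetric] strict_mono_less)
    with less show ?thesis by simp
  next
    case equal
    then show ?thesis using cr by (simp add: c_def)
  next
    case greater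
    then have "c > r" using cot_flow_strict_mono[OF m_pos] by (simp add: c_def cr[symmetric] strict_mono_less)
    with greater show ?thesis by simp
  qed
  finally show ?thesis .
qed

lemma sin_double_angle_flow_pos: "0 < sin (2 * angle_flow s)"
  using angle_flow_pos[of s] angle_flow_less[of s] by (intro sin_gt_zero) auto

lemma sgn_V_rhs:
  assumes "0 < V" shows "sgn (V_rhs \<beta> V b) = sgn (sin (2 * b)) * sgn (q - 32 * p * (sin b)\<^sup>2)"
proof -
  have "V_rhs \<beta> V b = 2 * (V powr (1/3))\<^sup>2 / (9 * \<beta>) * sin (2 * b) * (q - 32 * p * (sin b)\<^sup>2)"
    by (simp add: V_rhs_eq)
  moreover have "sgn (2 * (V powr (1/3))\<^sup>2 / (9 * \<beta>)) = 1"
    using assms \<beta>_pos by simp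
  ultimately show ?thesis by (simp only: sgn_mult mult_1)
qed

text \<open>Up to a multiple of \<open>pi\<close> the angle never leaves an open quadrant, so
  \<open>sin (2 b)\<close> keeps its sign and \<open>V'\<close> can vanish only through the other
  factor, which does so once.\<close>

lemma solution_signs:
  assumes "effective_solution \<beta> UNIV V b" "\<And>\<tau>. 0 < dust_density \<beta> \<kappa> (V \<tau>) (b \<tau>)"
  obtains \<sigma> t where "\<sigma> \<in> {1, -1}" "\<And>\<tau>. sgn (sin (2 * b \<tau>)) = \<sigma>"
    "\<And>\<tau>. sgn (q - 32 * p * (sin (b \<tau>))\<^sup>2) = \<sigma> * sgn (\<tau> - t)"
proof -
  obtain E \<sigma> a d where E: "0 < E" and \<sigma>: "\<sigma> \<in> {1, -1}" and a: "sin a = 0"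
    and b: "\<And>\<tau>. b \<tau> = a + \<sigma> * angle_flow (\<sigma> * flow_rate E * \<tau> + d)"
    using solution_is_flow[OF assms(1)] assms(2) by (metis UNIV_I)
  \<comment> \<open>The solution of
    \<open>\<sigma> * flow_rate E * t + d = critical_clock\<close>.\<close>
  define t where "t = \<sigma> * (critical_clock - d) / flow_rate E"
  have r: "flow_rate E > 0" by (rule flow_rate_pos[OF E])
  show ?thesis
  proof (rule that[OF \<sigma>])
    fix \<tau>
    show "sgn (sin (2 * b \<tau>)) = \<sigma>"
      using sin_double_angle_flow_pos \<sigma> unfolding b sin_double_shift[OF a \<sigma>]
      by (auto simp: sgn_mult)
    have "\<sigma> * flow_rate E * \<tau> + d - critical_clock = \<sigma> * flow_rate E * (\<tau> - t)"
      using r \<sigma> by (auto simp: t_def field_simps)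
    then show "sgn (q - 32 * p * (sin (b \<tau>))\<^sup>2) = \<sigma> * sgn (\<tau> - t)"
      using r \<sigma> unfolding b sin_shift_squared[OF a \<sigma>] sgn_slope_flow
      by (auto simp: sgn_mult)
  qed
qed

lemma critical_volume_pos: "0 < E \<Longrightarrow> 0 < critical_volume \<beta> \<kappa> E"
  using \<beta>_pos \<kappa>_pos p_pos q_pos
  unfolding critical_volume_def p_def[symmetric] q_def[symmetric] by simp

lemma critical_volume_eq: "critical_volume \<beta> \<kappa> E = (72 * \<beta>\<^sup>2 * \<kappa> * p * E / q\<^sup>2) ^ 3"
proof -
  have 8: "sqrt 2 ^ 6 = (8 :: real)" using power_mult[of "sqrt 2" 2 3] by simp
  have "(6 * sqrt 2 * \<beta> / q) ^ 6 = 72 ^ 3 * \<beta> ^ 6 / q ^ 6"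
    by (simp add: power_divide power_mult_distrib 8)
  then show ?thesis
    unfolding critical_volume_def p_def[symmetric] q_def[symmetric]
    by (simp add: power_divide power_mult_distrib power_mult[symmetric] 8)
qed

text \<open>At energy \<open>E\<close> the volume is a multiple of \<open>1 / G ^ 3\<close>, and
  \<open>critical_volume\<close> is its value for the maximal \<open>G\<close>, namely
  \<open>q\<^sup>2 / (64 p)\<close>. The distance from that maximum is a square divided by
  \<open>64 p\<close>.\<close>

lemma critical_volume_iff:
  assumes "0 < V" "0 < E" "energy \<beta> \<kappa> V b = E"
  shows "V = critical_volume \<beta> \<kappa> E \<longleftrightarrow> q - 32 * p * (sin b)\<^sup>2 = 0"
proof -
  define u where "u = V powr (1/3)"
  have u: "0 < u" using assms(1) by (simp add: u_def)
  have "72 * \<beta>\<^sup>2 * \<kappa> * p * E / q\<^sup>2 = 64 * p * u * G b / q\<^sup>2"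
    using \<beta>_pos \<kappa>_pos by (simp add: assms(3)[symmetric] energy_eq u_def)
  moreover have "V = u ^ 3" using cube_root_cubed[OF assms(1)] by (simp add: u_def)
  moreover have "0 \<le> 72 * \<beta>\<^sup>2 * \<kappa> * p * E / q\<^sup>2"
    using \<kappa>_pos p_pos assms(2) by simp
  ultimately have "V = critical_volume \<beta> \<kappa> E \<longleftrightarrow> u = 64 * p * u * G b / q\<^sup>2"
    unfolding critical_volume_eq using u by (simp only: power_eq_iff_eq_base zero_less_numeral less_imp_le)
  also have "\<dots> \<longleftrightarrow> q\<^sup>2 - 64 * p * G b = 0"
    using u q_pos by (simp add: field_simps)
  also have "q\<^sup>2 - 64 * p * G b = (q - 32 * p * (sin b)\<^sup>2)\<^sup>2"
    by (simp add: G_def power2_eq_square algebra_simps)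
  finally show ?thesis by simp
qed

lemma critical_sine_pos: "0 < critical_sine \<beta>"
  using p_pos q_pos unfolding critical_sine_def p_def[symmetric] q_def[symmetric] by simp

lemma critical_sine_squared: "(critical_sine \<beta>)\<^sup>2 = q / (32 * p)"
  using p_pos q_pos unfolding critical_sine_def p_def[symmetric] q_def[symmetric]
  by (simp add: power_mult_distrib power_divide)

lemma critical_slope_iff:
  "q - 32 * p * (sin b)\<^sup>2 = 0 \<longleftrightarrow> sin b \<in> {critical_sine \<beta>, - critical_sine \<beta>}"
proof -
  have "q - 32 * p * (sin b)\<^sup>2 = 0 \<longleftrightarrow> (sin b)\<^sup>2 = (critical_sine \<beta>)\<^sup>2"
    using p_pos by (auto simp: critical_sine_squared field_simps)
  then show ?thesis by (simp add: power2_eq_iff)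
qed

text \<open>\<sigma> enters \<open>V'\<close> twice, through \<open>sin (2 b)\<close> and through
  the order in which the slope changes sign. It cancels, so either sign gives contraction before
  \<open>t\<close> and expansion after it; what \<sigma> decides is which branch comes
  first.\<close>

lemma solution_bounces:
  assumes sol: "effective_solution \<beta> UNIV V b"
    and pos: "\<And>\<tau>. 0 < dust_density \<beta> \<kappa> (V \<tau>) (b \<tau>)"
    and E: "\<And>\<tau>. energy \<beta> \<kappa> (V \<tau>) (b \<tau>) = E"
  shows "\<exists>t. bounces_at V t
     \<and> strict_mono_on {..t} (\<lambda>\<tau>. dust_density \<beta> \<kappa> (V \<tau>) (b \<tau>))
     \<and> strict_antimono_on {t..} (\<lambda>\<tau>. dust_density \<beta> \<kappa> (V \<tau>) (b \<tau>))
     \<and> V t = critical_volume \<beta> \<kappa> E \<and> 0 < critical_volume \<beta> \<kappa> E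
     \<and> dust_density \<beta> \<kappa> (V t) (b t) = E / critical_volume \<beta> \<kappa> E
     \<and> sin (b t) \<in> {critical_sine \<beta>, - critical_sine \<beta>}
     \<and> ((\<forall>\<tau>. b \<tau> \<in> {-pi/2..pi/2}) \<longrightarrow>
          (sin (b t) = critical_sine \<beta> \<longrightarrow>
            (\<forall>\<tau><t. on_branch \<beta> \<kappa> BranchB 1 V b \<tau>) \<and>
            (\<forall>\<tau>>t. on_branch \<beta> \<kappa> BranchA 1 V b \<tau>)) \<and>
          (sin (b t) = - critical_sine \<beta> \<longrightarrow>
            (\<forall>\<tau><t. on_branch \<beta> \<kappa> BranchA (-1) V b \<tau>) \<and>
            (\<forall>\<tau>>t. on_branch \<beta> \<kappa> BranchB (-1) V b \<tau>)))"
proof -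
  note solD = effective_solutionD[OF sol UNIV_I]
  obtain \<sigma> t where \<sigma>: "\<sigma> \<in> {1, -1}" and s2: "\<And>\<tau>. sgn (sin (2 * b \<tau>)) = \<sigma>"
    and slope: "\<And>\<tau>. sgn (q - 32 * p * (sin (b \<tau>))\<^sup>2) = \<sigma> * sgn (\<tau> - t)"
    using solution_signs[OF sol pos] by blast
  have "\<sigma> * \<sigma> = 1" using \<sigma> by auto
  then have rate: "sgn (V_rhs \<beta> (V \<tau>) (b \<tau>)) = sgn (\<tau> - t)" for \<tau>
    unfolding sgn_V_rhs[OF solD(1)] s2 slope by (simp add: mult.assoc[symmetric])
  have rate_pos: "0 < V_rhs \<beta> (V \<tau>) (b \<tau>)" if "t < \<tau>" for \<tau>
    using rate[of \<tau>] that by (simp add: sgn_1_pos)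
  have rate_neg: "V_rhs \<beta> (V \<tau>) (b \<tau>) < 0" if "\<tau> < t" for \<tau>
    using rate[of \<tau>] that by (simp add: sgn_1_neg)
  have cont: "isCont V \<tau>" for \<tau> by (rule DERIV_isCont[OF solD(2)])
  have Epos: "0 < E"
    using pos[of t] solD(1)[of t] E[of t] by (simp add: dust_density_def zero_less_divide_iff)
  have \<rho>: "dust_density \<beta> \<kappa> (V \<tau>) (b \<tau>) = E / V \<tau>" for \<tau>
    by (simp add: dust_density_def E)
  \<comment> \<open>On this range \<open>cos b\<close> is nonnegative, so the sign of
    \<open>sin (2 b)\<close> is that of \<open>sin b\<close>.\<close>
  have sgn_b: "sgn (sin (b \<tau>)) = \<sigma>" if b: "\<forall>\<tau>. b \<tau> \<in> {-pi/2..pi/2}" for \<tau>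
  proof -
    have "cos (b \<tau>) \<ge> 0" using b by (auto intro: cos_ge_zero)
    moreover have "cos (b \<tau>) \<noteq> 0" using s2[of \<tau>] \<sigma> by (auto simp: sin_double)
    ultimately show ?thesis using s2[of \<tau>] by (simp add: sin_double sgn_mult)
  qed
  have "(V has_real_derivative 0) (at \<tau>) \<longleftrightarrow> \<tau> = t" for \<tau>
  proof -
    have "(V has_real_derivative 0) (at \<tau>) \<longleftrightarrow> V_rhs \<beta> (V \<tau>) (b \<tau>) = 0"
      using solD(2)[of \<tau>] DERIV_unique by metis
    then show ?thesis using rate[of \<tau>] by (metis eq_iff_diff_eq_0 sgn_0_0)
  qed
  moreover have mono: "strict_mono_on {t..} V"
    using cont solD(2) rate_pos by (intro strict_mono_on_atLeastI) blast+
  moreover have antimono: "strict_antimono_on {..t} V"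
    using cont solD(2) rate_neg by (intro strict_antimono_on_atMostI) blast+
  ultimately have "bounces_at V t" by (simp add: bounces_at_def)
  moreover have "strict_mono_on {..t} (\<lambda>\<tau>. dust_density \<beta> \<kappa> (V \<tau>) (b \<tau>))"
    using antimono Epos solD(1) unfolding \<rho>
    by (auto simp: monotone_on_def intro!: divide_strict_left_mono)
  moreover have "strict_antimono_on {t..} (\<lambda>\<tau>. dust_density \<beta> \<kappa> (V \<tau>) (b \<tau>))"
    using mono Epos solD(1) unfolding \<rho>
    by (auto simp: monotone_on_def intro!: divide_strict_left_mono)
  moreover have crit: "q - 32 * p * (sin (b t))\<^sup>2 = 0"
    using slope[of t] by (simp add: sgn_0_0)
  moreover have Vt: "V t = critical_volume \<beta> \<kappa> E"
    using critical_volume_iff[OF solD(1) Epos E] crit by simp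
  moreover have "(\<forall>\<tau><t. on_branch \<beta> \<kappa> BranchB 1 V b \<tau>) \<and> (\<forall>\<tau>>t. on_branch \<beta> \<kappa> BranchA 1 V b \<tau>)"
    if b: "\<forall>\<tau>. b \<tau> \<in> {-pi/2..pi/2}" and "sin (b t) = critical_sine \<beta>"
  proof -
    have "\<sigma> = 1" using sgn_b[OF b, of t] that(2) critical_sine_pos by simp
    then have *: "1 * \<bar>sin (b \<tau>)\<bar> = sin (b \<tau>)" for \<tau>
      using sgn_b[OF b, of \<tau>] by (simp add: sgn_1_pos)
    have "0 \<le> branch_sign BranchB * (q - 32 * p * (sin (b \<tau>))\<^sup>2)" if "\<tau> < t" for \<tau>
      using slope[of \<tau>] that \<open>\<sigma> = 1\<close> by (simp add: sgn_1_neg)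
    moreover have "0 \<le> branch_sign BranchA * (q - 32 * p * (sin (b \<tau>))\<^sup>2)" if "t < \<tau>" for \<tau>
      using slope[of \<tau>] that \<open>\<sigma> = 1\<close> by (simp add: sgn_1_pos)
    ultimately show ?thesis
      using on_branchI[OF sol UNIV_I pos _ _ *] b by blast
  qed
  moreover have "(\<forall>\<tau><t. on_branch \<beta> \<kappa> BranchA (-1) V b \<tau>) \<and> (\<forall>\<tau>>t. on_branch \<beta> \<kappa> BranchB (-1) V b \<tau>)"
    if b: "\<forall>\<tau>. b \<tau> \<in> {-pi/2..pi/2}" and "sin (b t) = - critical_sine \<beta>"
  proof -
    have "\<sigma> = -1" using sgn_b[OF b, of t] that(2) critical_sine_pos by simp
    then have *: "-1 * \<bar>sin (b \<tau>)\<bar> = sin (b \<tau>)" for \<tau>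
      using sgn_b[OF b, of \<tau>] by (simp add: sgn_1_neg)
    have "0 \<le> branch_sign BranchA * (q - 32 * p * (sin (b \<tau>))\<^sup>2)" if "\<tau> < t" for \<tau>
      using slope[of \<tau>] that \<open>\<sigma> = -1\<close> by (simp add: sgn_1_pos)
    moreover have "0 \<le> branch_sign BranchB * (q - 32 * p * (sin (b \<tau>))\<^sup>2)" if "t < \<tau>" for \<tau>
      using slope[of \<tau>] that \<open>\<sigma> = -1\<close> by (simp add: sgn_1_neg)
    ultimately show ?thesis
      using on_branchI[OF sol UNIV_I pos _ _ *] b by blast
  qed
  ultimately show ?thesis
    using critical_volume_pos[OF Epos] critical_slope_iff[of "b t"] \<rho>[of t]
    by (intro exI[of _ t]) simp
qed

section \<open>Gluing of branches at the bounce\<close>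

lemma sgn_branch_rate:
  assumes "0 < V" "0 < \<rho>" "0 < discr \<beta> \<kappa> V \<rho>" "\<sigma> \<in> {1, -1}"
  shows "sgn (branch_rate \<beta> \<kappa> r \<sigma> V \<rho>) = \<sigma> * branch_sign r"
proof -
  define D where "D = discr \<beta> \<kappa> V \<rho>"
  have "sqrt D < q"
    using discr_less[OF assms(1,2)] q_pos real_sqrt_less_mono[of D "q\<^sup>2"] by (simp add: D_def)
  moreover have "0 < sqrt D" using assms(3) by (simp add: D_def)
  moreover have "0 \<le> 4 * p * (\<kappa> * \<rho> * V powr (2/3))"
    using p_pos \<kappa>_pos assms(2) by simp
  moreover have "branch_sign r * sqrt D < q"
  proof -
    have "- sqrt D < q" using calculation q_pos by linarith
    then show ?thesis using calculation(1) by (cases r) simp_all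
  qed
  ultimately have "0 < q + 4 * p * (\<kappa> * \<rho> * V powr (2/3)) - branch_sign r * sqrt D"
    by linarith
  then have "0 < V powr (2/3) / (12 * sqrt 2 * p) * sqrt D
      * sqrt (q + 4 * p * (\<kappa> * \<rho> * V powr (2/3)) - branch_sign r * sqrt D)"
    using \<open>0 < sqrt D\<close> assms(1) p_pos by (intro mult_pos_pos) auto
  then have "sgn (V powr (2/3) / (12 * sqrt 2 * p) * sqrt D
      * sqrt (q + 4 * p * (\<kappa> * \<rho> * V powr (2/3)) - branch_sign r * sqrt D)) = 1"
    by (simp only: sgn_1_pos)
  moreover have "branch_rate \<beta> \<kappa> r \<sigma> V \<rho> = \<sigma> * branch_sign r * (V powr (2/3) / (12 * sqrt 2 * p) * sqrt D
      * sqrt (q + 4 * p * (\<kappa> * \<rho> * V powr (2/3)) - branch_sign r * sqrt D))"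
    unfolding branch_rate_eq D_def by simp
  moreover have "sgn (\<sigma> * branch_sign r) = \<sigma> * branch_sign r"
    using assms(4) by (cases r) auto
  ultimately show ?thesis by (simp only: sgn_mult[of "\<sigma> * branch_sign r"] mult_1_right)
qed

text \<open>Formulated for functions glued from two branches, with mere continuity of
  \<open>V\<close> and \<open>sin b\<close> at \<open>0\<close>. Since \<open>V 0\<close> is a
  strict local minimum, \<open>V'\<close> cannot be positive on the left or negative on the right,
  which fixes each product of \<sigma> and \<open>branch_sign\<close>. Continuity and
  \<open>sin (b 0) \<noteq> 0\<close> force the two signs of the angle to agree, and only the
  crossings between A and B remain.\<close>

lemma branch_connection:
  assumes \<sigma>: "\<sigma>\<^sub>1 \<in> {1, -1}" "\<sigma>\<^sub>2 \<in> {1, -1}" and "0 < E" "0 < \<epsilon>"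
    and V0: "V 0 = critical_volume \<beta> \<kappa> E" and contV: "isCont V 0"
    and energy: "\<And>\<tau>. \<bar>\<tau>\<bar> < \<epsilon> \<Longrightarrow> energy \<beta> \<kappa> (V \<tau>) (b \<tau>) = E"
    and larger: "\<And>\<tau>. 0 < \<bar>\<tau>\<bar> \<Longrightarrow> \<bar>\<tau>\<bar> < \<epsilon> \<Longrightarrow> V 0 < V \<tau>"
    and left: "\<And>\<tau>. - \<epsilon> < \<tau> \<Longrightarrow> \<tau> < 0 \<Longrightarrow> on_branch \<beta> \<kappa> r\<^sub>1 \<sigma>\<^sub>1 V b \<tau>"
    and right: "\<And>\<tau>. 0 < \<tau> \<Longrightarrow> \<tau> < \<epsilon> \<Longrightarrow> on_branch \<beta> \<kappa> r\<^sub>2 \<sigma>\<^sub>2 V b \<tau>"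
    and cont: "isCont (\<lambda>\<tau>. sin (b \<tau>)) 0"
  shows "(r\<^sub>1 = BranchB \<and> \<sigma>\<^sub>1 = 1 \<and> r\<^sub>2 = BranchA \<and> \<sigma>\<^sub>2 = 1) \<or>
    (r\<^sub>1 = BranchA \<and> \<sigma>\<^sub>1 = -1 \<and> r\<^sub>2 = BranchB \<and> \<sigma>\<^sub>2 = -1)"
proof -
  have V0_pos: "0 < V 0" using critical_volume_pos[OF \<open>0 < E\<close>] V0 by simp
  have "sin (b 0) \<noteq> 0"
  proof -
    have "q - 32 * p * (sin (b 0))\<^sup>2 = 0"
      using critical_volume_iff[OF V0_pos \<open>0 < E\<close> energy] V0 \<open>0 < \<epsilon>\<close> by simp
    then show ?thesis using critical_slope_iff[of "b 0"] critical_sine_pos by auto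
  qed
  have branch: "sin (b \<tau>) = \<sigma> * \<bar>sin (b \<tau>)\<bar>"
      "\<exists>y. (V has_real_derivative y) (at \<tau>) \<and> sgn y = \<sigma> * branch_sign r"
    if \<tau>: "0 < \<bar>\<tau>\<bar>" "\<bar>\<tau>\<bar> < \<epsilon>" and on: "on_branch \<beta> \<kappa> r \<sigma> V b \<tau>" and \<sigma>: "\<sigma> \<in> {1, -1}" for \<tau> r \<sigma>
  proof -
    define \<rho> where "\<rho> = dust_density \<beta> \<kappa> (V \<tau>) (b \<tau>)"
    have V: "0 < V \<tau>" using larger[OF \<tau>] V0_pos by simp
    then have \<rho>: "0 < \<rho>" using energy[OF \<tau>(2)] \<open>0 < E\<close> by (simp add: \<rho>_def dust_density_def)
    have "q - 32 * p * (sin (b \<tau>))\<^sup>2 \<noteq> 0"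
      using critical_volume_iff[OF V \<open>0 < E\<close> energy[OF \<tau>(2)]] larger[OF \<tau>] V0 by auto
    then have D: "0 < discr \<beta> \<kappa> (V \<tau>) \<rho>"
      by (simp add: \<rho>_def discr_dust_density[OF V])
    have "b \<tau> = branch_angle \<beta> \<kappa> r \<sigma> (V \<tau>) \<rho>"
      "(V has_real_derivative branch_rate \<beta> \<kappa> r \<sigma> (V \<tau>) \<rho>) (at \<tau>)"
      using on by (auto simp: on_branch_def Let_def \<rho>_def)
    then show "sin (b \<tau>) = \<sigma> * \<bar>sin (b \<tau>)\<bar>"
      "\<exists>y. (V has_real_derivative y) (at \<tau>) \<and> sgn y = \<sigma> * branch_sign r"
      using branch_angle_sin_squared(2)[OF V \<rho> less_imp_le[OF D] \<sigma>] sgn_branch_rate[OF V \<rho> D \<sigma>] by blast+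
  qed
  have left': "sin (b \<tau>) = \<sigma>\<^sub>1 * \<bar>sin (b \<tau>)\<bar>"
      "\<exists>y. (V has_real_derivative y) (at \<tau>) \<and> sgn y = \<sigma>\<^sub>1 * branch_sign r\<^sub>1" if "- \<epsilon> < \<tau>" "\<tau> < 0" for \<tau>
    using branch[OF _ _ left[OF that] \<sigma>(1)] that by auto
  have right': "sin (b \<tau>) = \<sigma>\<^sub>2 * \<bar>sin (b \<tau>)\<bar>"
      "\<exists>y. (V has_real_derivative y) (at \<tau>) \<and> sgn y = \<sigma>\<^sub>2 * branch_sign r\<^sub>2" if "0 < \<tau>" "\<tau> < \<epsilon>" for \<tau>
    using branch[OF _ _ right[OF that] \<sigma>(2)] that by auto
  have V_cont: "isCont V \<tau>" if "\<bar>\<tau>\<bar> < \<epsilon>" for \<tau>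
  proof (cases \<tau> "0::real" rule: linorder_cases)
    case less
    then show ?thesis using left'(2)[of \<tau>] that by (auto intro: DERIV_isCont)
  next
    case equal
    then show ?thesis using contV by simp
  next
    case greater
    then show ?thesis using right'(2)[of \<tau>] that by (auto intro: DERIV_isCont)
  qed
  have "\<sigma>\<^sub>1 * branch_sign r\<^sub>1 \<noteq> 1"
  proof
    assume *: "\<sigma>\<^sub>1 * branch_sign r\<^sub>1 = 1"
    have "V (- \<epsilon> / 2) < V 0"
    proof (rule DERIV_pos_imp_increasing_open[of "- \<epsilon> / 2" 0 V])
      show "\<exists>y. (V has_real_derivative y) (at \<tau>) \<and> 0 < y" if "- \<epsilon> / 2 < \<tau>" "\<tau> < 0" for \<tau>
        using left'(2)[of \<tau>] that \<open>0 < \<epsilon>\<close> by (auto simp: * sgn_1_pos)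
      show "continuous_on {- \<epsilon> / 2..0} V"
        using \<open>0 < \<epsilon>\<close> by (intro continuous_at_imp_continuous_on ballI V_cont) auto
    qed (use \<open>0 < \<epsilon>\<close> in simp)
    then show False using larger[of "- \<epsilon> / 2"] \<open>0 < \<epsilon>\<close> by simp
  qed
  moreover have "\<sigma>\<^sub>2 * branch_sign r\<^sub>2 \<noteq> -1"
  proof
    assume *: "\<sigma>\<^sub>2 * branch_sign r\<^sub>2 = -1"
    have "V 0 > V (\<epsilon> / 2)"
    proof (rule DERIV_neg_imp_decreasing_open[of 0 "\<epsilon> / 2" V])
      show "\<exists>y. (V has_real_derivative y) (at \<tau>) \<and> y < 0" if "0 < \<tau>" "\<tau> < \<epsilon> / 2" for \<tau>
        using right'(2)[of \<tau>] that \<open>0 < \<epsilon>\<close> by (auto simp: * sgn_1_neg)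
      show "continuous_on {0..\<epsilon> / 2} V"
        using \<open>0 < \<epsilon>\<close> by (intro continuous_at_imp_continuous_on ballI V_cont) auto
    qed (use \<open>0 < \<epsilon>\<close> in simp)
    then show False using larger[of "\<epsilon> / 2"] \<open>0 < \<epsilon>\<close> by simp
  qed
  moreover have "\<sigma>\<^sub>1 = \<sigma>\<^sub>2"
  proof -
    have lim: "((\<lambda>\<tau>. \<sigma> * sin (b \<tau>)) \<longlongrightarrow> \<sigma> * sin (b 0)) (at 0 within S)" for \<sigma> S
      using cont by (intro tendsto_mult_left) (auto simp: isCont_def intro: tendsto_within_subset)
    have "\<forall>\<^sub>F \<tau> in at_left 0. 0 \<le> \<sigma>\<^sub>1 * sin (b \<tau>)"
    proof (rule eventually_at_leftI[of "- \<epsilon>"])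
      fix \<tau> assume "\<tau> \<in> {- \<epsilon><..<0}"
      then show "0 \<le> \<sigma>\<^sub>1 * sin (b \<tau>)" using left'(1)[of \<tau>] \<sigma>(1) by auto
    qed (use \<open>0 < \<epsilon>\<close> in simp)
    then have "0 \<le> \<sigma>\<^sub>1 * sin (b 0)" by (intro tendsto_lowerbound[OF lim]) auto
    moreover have "\<forall>\<^sub>F \<tau> in at_right 0. 0 \<le> \<sigma>\<^sub>2 * sin (b \<tau>)"
    proof (rule eventually_at_rightI[of _ \<epsilon>])
      fix \<tau> assume "\<tau> \<in> {0<..<\<epsilon>}"
      then show "0 \<le> \<sigma>\<^sub>2 * sin (b \<tau>)" using right'(1)[of \<tau>] \<sigma>(2) by auto
    qed (use \<open>0 < \<epsilon>\<close> in simp)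
    then have "0 \<le> \<sigma>\<^sub>2 * sin (b 0)" by (intro tendsto_lowerbound[OF lim]) auto
    ultimately show ?thesis using \<open>sin (b 0) \<noteq> 0\<close> \<sigma> by auto
  qed
  ultimately show ?thesis
    using \<sigma> by (cases r\<^sub>1; cases r\<^sub>2) auto
qed


section \<open>Solutions with prescribed bounce volume\<close>

definition critical_energy :: "real \<Rightarrow> real" where
  "critical_energy Vc = q\<^sup>2 * Vc powr (1/3) / (72 * \<beta>\<^sup>2 * \<kappa> * p)"

lemma critical_energy_pos: "0 < Vc \<Longrightarrow> 0 < critical_energy Vc"
  using \<beta>_pos \<kappa>_pos p_pos q_pos by (simp add: critical_energy_def)

lemma critical_volume_eq_iff:
  assumes "0 < Vc" "0 < E"
  shows "Vc = critical_volume \<beta> \<kappa> E \<longleftrightarrow> E = critical_energy Vc"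
proof -
  define u where "u = Vc powr (1/3)"
  have u: "0 < u" using assms(1) by (simp add: u_def)
  have "Vc = u ^ 3" using cube_root_cubed[OF assms(1)] by (simp add: u_def)
  moreover have "0 \<le> 72 * \<beta>\<^sup>2 * \<kappa> * p * E / q\<^sup>2"
    using \<kappa>_pos p_pos assms(2) by simp
  ultimately have "Vc = critical_volume \<beta> \<kappa> E \<longleftrightarrow> u = 72 * \<beta>\<^sup>2 * \<kappa> * p * E / q\<^sup>2"
    unfolding critical_volume_eq using u by (simp only: power_eq_iff_eq_base zero_less_numeral less_imp_le)
  also have "\<dots> \<longleftrightarrow> E = critical_energy Vc"
    using \<beta>_pos \<kappa>_pos p_pos q_pos by (auto simp: critical_energy_def u_def[symmetric] field_simps)
  finally show ?thesis .
qed

text \<open>The offset \<open>critical_clock\<close> puts the bounce at time \<open>0\<close>. As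
  \<sigma> enters only through \<open>\<sigma> * \<tau>\<close>, the two signs give time-reflected
  volumes.\<close>

definition bounce_volume :: "real \<Rightarrow> real \<Rightarrow> real \<Rightarrow> real" where
  "bounce_volume Vc \<sigma> \<tau> = flow_volume (critical_energy Vc) (\<sigma> * flow_rate (critical_energy Vc) * \<tau> + critical_clock)"

definition bounce_angle :: "real \<Rightarrow> real \<Rightarrow> real \<Rightarrow> real" where
  "bounce_angle Vc \<sigma> \<tau> = \<sigma> * angle_flow (\<sigma> * flow_rate (critical_energy Vc) * \<tau> + critical_clock)"

lemma bounce_solution_flow:
  assumes "0 < Vc" "\<sigma> \<in> {1, -1}" "sin a = 0"
  shows "bounce_solution \<beta> \<kappa> Vc (bounce_volume Vc \<sigma>) (\<lambda>\<tau>. a + bounce_angle Vc \<sigma> \<tau>)"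
proof -
  let ?V = "bounce_volume Vc \<sigma>" and ?b = "\<lambda>\<tau>. a + bounce_angle Vc \<sigma> \<tau>"
  have E: "0 < critical_energy Vc" by (rule critical_energy_pos[OF assms(1)])
  note flow = flow_solution[OF E assms(3,2), where d = critical_clock,
      folded bounce_volume_def bounce_angle_def, folded bounce_volume_def[abs_def]]
  have V: "0 < ?V 0" by (rule effective_solutionD(1)[OF flow(1) UNIV_I])
  have slope: "q - 32 * p * (sin (?b 0))\<^sup>2 = 0"
    unfolding bounce_angle_def sin_shift_squared[OF assms(3,2)]
    using sgn_slope_flow[of critical_clock] by (simp add: sgn_0_0)
  then have "?V 0 = critical_volume \<beta> \<kappa> (critical_energy Vc)"
    using critical_volume_iff[OF V E flow(2)] by simp
  then have "?V 0 = Vc"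
    using critical_volume_eq_iff[OF assms(1) E] by simp
  moreover have "V_rhs \<beta> (?V 0) (?b 0) = 0"
    unfolding V_rhs_eq slope by simp
  then have "(?V has_real_derivative 0) (at 0)"
    using effective_solutionD(2)[OF flow(1) UNIV_I, of 0] by simp
  ultimately show ?thesis
    using flow(1,3) by (simp add: bounce_solution_def)
qed

text \<open>The bounce conditions use up two of the four constants of
  \<open>solution_is_flow\<close>: \<open>V' = 0\<close> at time \<open>0\<close> forces
  \<open>d = critical_clock\<close>, because \<open>sin (2 b)\<close> never vanishes, and
  \<open>V 0 = Vc\<close> fixes the energy. The sign and the multiple of \<open>pi\<close> stay
  free.\<close>

lemma bounce_solution_is_flow:
  assumes "0 < Vc" "bounce_solution \<beta> \<kappa> Vc V b"
  obtains \<sigma> a where "\<sigma> \<in> {1, -1}" "sin a = 0" "V = bounce_volume Vc \<sigma>"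
    "b = (\<lambda>\<tau>. a + bounce_angle Vc \<sigma> \<tau>)"
proof -
  have sol: "effective_solution \<beta> UNIV V b" and pos: "\<And>\<tau>. 0 < dust_density \<beta> \<kappa> (V \<tau>) (b \<tau>)"
    and V0: "V 0 = Vc" and dV: "(V has_real_derivative 0) (at 0)"
    using assms(2) by (auto simp: bounce_solution_def)
  obtain E \<sigma> a d where E: "0 < E" and \<sigma>: "\<sigma> \<in> {1, -1}" and a: "sin a = 0"
    and V: "\<And>\<tau>. V \<tau> = flow_volume E (\<sigma> * flow_rate E * \<tau> + d)"
    and b: "\<And>\<tau>. b \<tau> = a + \<sigma> * angle_flow (\<sigma> * flow_rate E * \<tau> + d)"
    using solution_is_flow[OF sol] pos by (metis UNIV_I)
  have "V_rhs \<beta> (V 0) (b 0) = 0"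
    using DERIV_unique[OF effective_solutionD(2)[OF sol UNIV_I] dV] .
  then have "sgn (sin (2 * b 0)) * sgn (q - 32 * p * (sin (b 0))\<^sup>2) = 0"
    using sgn_V_rhs[OF effective_solutionD(1)[OF sol UNIV_I], of 0 "b 0"] by simp
  moreover have "sin (2 * b 0) \<noteq> 0"
    unfolding b sin_double_shift[OF a \<sigma>] using \<sigma> sin_double_angle_flow_pos[of "\<sigma> * flow_rate E * 0 + d"] by auto
  ultimately have slope: "q - 32 * p * (sin (b 0))\<^sup>2 = 0" by (simp add: sgn_0_0)
  moreover have "sgn (q - 32 * p * (sin (b 0))\<^sup>2) = sgn (d - critical_clock)"
    unfolding b sin_shift_squared[OF a \<sigma>] sgn_slope_flow by simp
  ultimately have "sgn (d - critical_clock) = 0" by simp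
  then have d: "d = critical_clock" by (simp add: sgn_0_0)
  have "energy \<beta> \<kappa> (V 0) (b 0) = E"
    unfolding V b by (rule flow_solution(2)[OF E a \<sigma>])
  then have "Vc = critical_volume \<beta> \<kappa> E"
    using critical_volume_iff[of "V 0" E "b 0"] E slope V0 assms(1) by simp
  then have "E = critical_energy Vc"
    using critical_volume_eq_iff[OF assms(1) E] by simp
  then show ?thesis
    using that[OF \<sigma> a] V b d by (auto simp: fun_eq_iff bounce_volume_def bounce_angle_def)
qed

lemma bounce_angle_bounds:
  assumes "\<sigma> \<in> {1, -1}"
  shows "0 < \<sigma> * bounce_angle Vc \<sigma> \<tau>" "\<bar>bounce_angle Vc \<sigma> \<tau>\<bar> < pi / 2"
  using assms angle_flow_pos angle_flow_less by (auto simp: bounce_angle_def abs_of_pos)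

lemma bounded_bounce_solutions:
  assumes "0 < Vc"
  shows "{(V, b). bounce_solution \<beta> \<kappa> Vc V b \<and> (\<forall>\<tau>. b \<tau> \<in> {-pi/2..pi/2})}
    = {(bounce_volume Vc 1, bounce_angle Vc 1), (bounce_volume Vc (-1), bounce_angle Vc (-1))}" (is "?L = ?R")
proof (rule set_eqI, clarify)
  fix V b
  show "(V, b) \<in> ?L \<longleftrightarrow> (V, b) \<in> ?R"
  proof
    assume "(V, b) \<in> ?L"
    then have *: "bounce_solution \<beta> \<kappa> Vc V b" and range: "b 0 \<in> {-pi/2..pi/2}" by auto
    obtain \<sigma> a where \<sigma>: "\<sigma> \<in> {1, -1}" and a: "sin a = 0" and V: "V = bounce_volume Vc \<sigma>"
      and b: "b = (\<lambda>\<tau>. a + bounce_angle Vc \<sigma> \<tau>)"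
      using bounce_solution_is_flow[OF assms *] .
    \<comment> \<open>Both \<open>b 0\<close> and the bounce angle are at most \<open>pi / 2\<close>
      in absolute value, the latter strictly.\<close>
    have "- pi < a \<and> a < pi"
      using range bounce_angle_bounds(2)[OF \<sigma>, of Vc 0] unfolding b by auto
    then have "a = 0" using a sin_eq_0_pi by blast
    then show "(V, b) \<in> ?R" using \<sigma> V b by auto
  next
    assume "(V, b) \<in> ?R"
    then obtain \<sigma> where \<sigma>: "\<sigma> \<in> {1, -1}" and V: "V = bounce_volume Vc \<sigma>" and b: "b = bounce_angle Vc \<sigma>"
      by auto
    have "bounce_solution \<beta> \<kappa> Vc V b"
      using bounce_solution_flow[OF assms \<sigma>, of 0] by (simp add: V b)
    moreover have "b \<tau> \<in> {-pi/2..pi/2}" for \<tau>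
      using bounce_angle_bounds(2)[OF \<sigma>, of Vc \<tau>] unfolding b by auto
    ultimately show "(V, b) \<in> ?L" by simp
  qed
qed

lemma bounce_volumes:
  assumes "0 < Vc"
  shows "{V. \<exists>b. bounce_solution \<beta> \<kappa> Vc V b} = {bounce_volume Vc 1, bounce_volume Vc (-1)}"
proof (intro set_eqI iffI)
  fix V assume "V \<in> {V. \<exists>b. bounce_solution \<beta> \<kappa> Vc V b}"
  then show "V \<in> {bounce_volume Vc 1, bounce_volume Vc (-1)}"
    using bounce_solution_is_flow[OF assms] by blast
next
  fix V assume "V \<in> {bounce_volume Vc 1, bounce_volume Vc (-1)}"
  then show "V \<in> {V. \<exists>b. bounce_solution \<beta> \<kappa> Vc V b}"
    using bounce_solution_flow[OF assms, of 1 0] bounce_solution_flow[OF assms, of "-1" 0] by auto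
qed

lemma bounce_angle_0:
  assumes "\<sigma> \<in> {1, -1}"
  shows "bounce_angle Vc \<sigma> 0 = arcsin (\<sigma> * critical_sine \<beta>)"
proof -
  have range: "0 < angle_flow critical_clock" "angle_flow critical_clock < pi / 2"
    by (rule angle_flow)+
  have "0 < sin (angle_flow critical_clock)"
    using range by (intro sin_gt_zero) auto
  moreover have "q - 32 * p * (sin (angle_flow critical_clock))\<^sup>2 = 0"
    using sgn_slope_flow[of critical_clock] by (simp add: sgn_0_0)
  ultimately have "sin (angle_flow critical_clock) = critical_sine \<beta>"
    using critical_slope_iff critical_sine_pos by fastforce
  then have "sin (bounce_angle Vc \<sigma> 0) = \<sigma> * critical_sine \<beta>"
    using assms by (auto simp: bounce_angle_def)
  then have "arcsin (\<sigma> * critical_sine \<beta>) = arcsin (sin (bounce_angle Vc \<sigma> 0))" by simp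
  also have "\<dots> = bounce_angle Vc \<sigma> 0"
    using bounce_angle_bounds(2)[OF assms, of Vc 0] by (intro arcsin_sin) auto
  finally show ?thesis by simp
qed

lemma bounce_volume_reflect: "bounce_volume Vc (-1) \<tau> = bounce_volume Vc 1 (- \<tau>)"
  by (simp add: bounce_volume_def)

text \<open>
  In a reflection-symmetric solution the two angles at times \<open>1\<close> and \<open>-1\<close> would be the two different
  roots of the same energy equation, with opposite \<open>dV/d\<tau>\<close>. The first makes the sum of their
  \<open>(sin b)\<^sup>2\<close> equal to \<open>q / (16 p) < 1\<close>, the second makes it equal to \<open>1\<close>.
\<close>

lemma bounce_not_symmetric:
  assumes "bounce_solution \<beta> \<kappa> Vc V b"
  shows "\<not> (\<forall>\<tau>. V (- \<tau>) = V \<tau>)"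
proof
  assume sym: "\<forall>\<tau>. V (- \<tau>) = V \<tau>"
  have sol: "effective_solution \<beta> UNIV V b" and pos: "\<And>\<tau>. 0 < dust_density \<beta> \<kappa> (V \<tau>) (b \<tau>)"
    and dV: "(V has_real_derivative 0) (at 0)"
    using assms by (auto simp: bounce_solution_def)
  note solD = effective_solutionD[OF sol UNIV_I]
  obtain \<sigma> t where \<sigma>: "\<sigma> \<in> {1, -1}" and s2: "\<And>\<tau>. sgn (sin (2 * b \<tau>)) = \<sigma>"
    and slope: "\<And>\<tau>. sgn (q - 32 * p * (sin (b \<tau>))\<^sup>2) = \<sigma> * sgn (\<tau> - t)"
    using solution_signs[OF sol pos] by blast
  have "V_rhs \<beta> (V 0) (b 0) = 0" by (rule DERIV_unique[OF solD(2) dV])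
  then have "\<sigma> * (\<sigma> * sgn (0 - t)) = 0"
    using sgn_V_rhs[OF solD(1), of 0 "b 0"] by (simp add: s2 slope)
  then have t: "t = 0" using \<sigma> by (auto simp: sgn_0_0)
  define x y where "x = (sin (b 1))\<^sup>2" and "y = (sin (b (-1)))\<^sup>2"
  have "x \<noteq> y" using slope[of 1] slope[of "-1"] \<sigma> by (auto simp: x_def y_def t)
  have V1: "V (-1) = V 1" using sym by blast
  define v where "v = V 1 powr (1/3)"
  have v: "0 < v" using solD(1)[of 1] by (simp add: v_def)
  obtain E where E: "\<And>\<tau>. energy \<beta> \<kappa> (V \<tau>) (b \<tau>) = E"
    using energy_conserved[OF sol] by (metis UNIV_I)
  have "energy \<beta> \<kappa> (V 1) (b 1) = energy \<beta> \<kappa> (V (-1)) (b (-1))" by (simp add: E)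
  then have "G (b 1) = G (b (-1))"
    using v \<beta>_pos \<kappa>_pos by (simp add: energy_eq V1 v_def[symmetric])
  then have "(x - y) * (q - 16 * p * (x + y)) = 0"
    by (simp add: G_def x_def[symmetric] y_def[symmetric] algebra_simps)
  then have q: "q = 16 * p * (x + y)" using \<open>x \<noteq> y\<close> by simp
  have "((\<lambda>\<tau>. V (- \<tau>)) has_real_derivative V_rhs \<beta> (V (-1)) (b (-1)) * - 1) (at 1)"
    by (rule DERIV_chain2[where f = V]) (use solD(2)[of "-1"] in \<open>auto intro!: derivative_eq_intros\<close>)
  then have "(V has_real_derivative - V_rhs \<beta> (V (-1)) (b (-1))) (at 1)"
    using sym by simp
  then have "V_rhs \<beta> (V 1) (b 1) = - V_rhs \<beta> (V (-1)) (b (-1))"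
    by (rule DERIV_unique[OF solD(2)])
  moreover define K where "K = 2 * v\<^sup>2 / (9 * \<beta>)"
  moreover have "V_rhs \<beta> (V 1) (b 1) = K * (sin (2 * b 1) * (q - 32 * p * x))"
    "V_rhs \<beta> (V (-1)) (b (-1)) = K * (sin (2 * b (-1)) * (q - 32 * p * y))"
    by (simp_all add: V_rhs_eq V1 v_def[symmetric] K_def x_def y_def)
  ultimately have "K * (sin (2 * b 1) * (q - 32 * p * x) + sin (2 * b (-1)) * (q - 32 * p * y)) = 0"
    by (simp only: distrib_left add.left_inverse)
  moreover have "K \<noteq> 0" using v \<beta>_pos by (simp add: K_def)
  ultimately have "sin (2 * b 1) * (q - 32 * p * x) + sin (2 * b (-1)) * (q - 32 * p * y) = 0"
    by (simp only: mult_eq_0_iff simp_thms)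
  then have "(sin (2 * b 1) - sin (2 * b (-1))) * (16 * p * (x - y)) = 0"
    by (simp add: q algebra_simps)
  then have "(sin (2 * b 1))\<^sup>2 = (sin (2 * b (-1)))\<^sup>2"
    using p_pos \<open>x \<noteq> y\<close> by simp
  then have "x * (1 - x) = y * (1 - y)"
    by (simp add: sin_double power_mult_distrib cos_squared_eq x_def y_def)
  then have "(x - y) * (1 - (x + y)) = 0" by (simp add: algebra_simps)
  then have "x + y = 1" using \<open>x \<noteq> y\<close> by simp
  then show False using q q_less by simp
qed

lemma bounce_solution_bounces:
  assumes "bounce_solution \<beta> \<kappa> Vc V b"
  shows "bounces_at V 0" "Vc \<le> V \<tau>"
proof -
  have sol: "effective_solution \<beta> UNIV V b" and pos: "\<And>\<tau>. 0 < dust_density \<beta> \<kappa> (V \<tau>) (b \<tau>)"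
    and V0: "V 0 = Vc" and dV: "(V has_real_derivative 0) (at 0)"
    using assms by (auto simp: bounce_solution_def)
  obtain E where "\<And>\<tau>. energy \<beta> \<kappa> (V \<tau>) (b \<tau>) = E"
    using energy_conserved[OF sol] by (metis UNIV_I)
  then obtain t where t: "bounces_at V t"
    using solution_bounces[OF sol pos] by blast
  then have "t = 0" using dV by (auto simp: bounces_at_def)
  then show "bounces_at V 0" using t by simp
  then have anti: "strict_antimono_on {..0} V" and mono: "strict_mono_on {0..} V"
    by (auto simp: bounces_at_def)
  show "Vc \<le> V \<tau>"
    using monotone_onD[OF mono, of 0 \<tau>] monotone_onD[OF anti, of \<tau> 0] V0
    by (cases \<tau> "0::real" rule: linorder_cases) auto
qed

text \<open>On \<open>I\<close> the solution is given by the flow formula, which makes sense and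
  solves the equations at all times.\<close>

lemma solution_extends:
  assumes "effective_solution \<beta> I V b" "\<And>\<tau>. \<tau> \<in> I \<Longrightarrow> 0 < dust_density \<beta> \<kappa> (V \<tau>) (b \<tau>)"
  shows "\<exists>V' b'. effective_solution \<beta> UNIV V' b' \<and> (\<forall>\<tau>\<in>I. V' \<tau> = V \<tau> \<and> b' \<tau> = b \<tau>)"
proof -
  obtain E \<sigma> a d where E: "0 < E" "\<sigma> \<in> {1, -1}" "sin a = 0"
    and V: "\<And>\<tau>. \<tau> \<in> I \<Longrightarrow> V \<tau> = flow_volume E (\<sigma> * flow_rate E * \<tau> + d)"
    and b: "\<And>\<tau>. \<tau> \<in> I \<Longrightarrow> b \<tau> = a + \<sigma> * angle_flow (\<sigma> * flow_rate E * \<tau> + d)"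
    using solution_is_flow[OF assms] by blast
  show ?thesis
    using flow_solution(1)[OF E(1,3,2), of d] V b
    by (intro exI[of _ "\<lambda>\<tau>. flow_volume E (\<sigma> * flow_rate E * \<tau> + d)"]
        exI[of _ "\<lambda>\<tau>. a + \<sigma> * angle_flow (\<sigma> * flow_rate E * \<tau> + d)"]) auto
qed

lemma two_bounce_solutions:
  assumes "0 < Vc"
  shows "\<exists>V\<^sub>1 b\<^sub>1 V\<^sub>2 b\<^sub>2.
        {(V, b). bounce_solution \<beta> \<kappa> Vc V b \<and> (\<forall>\<tau>. b \<tau> \<in> {-pi/2..pi/2})}
          = {(V\<^sub>1, b\<^sub>1), (V\<^sub>2, b\<^sub>2)}
      \<and> {V. \<exists>b. bounce_solution \<beta> \<kappa> Vc V b} = {V\<^sub>1, V\<^sub>2}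
      \<and> b\<^sub>1 0 = arcsin (critical_sine \<beta>) \<and> b\<^sub>2 0 = arcsin (- critical_sine \<beta>) \<and> b\<^sub>1 0 \<noteq> b\<^sub>2 0
      \<and> (\<forall>c\<^sub>1 c\<^sub>2. (\<forall>\<tau>. c\<^sub>1 * V\<^sub>1 \<tau> + c\<^sub>2 * V\<^sub>2 \<tau> = 0) \<longrightarrow> c\<^sub>1 = 0 \<and> c\<^sub>2 = 0)
      \<and> (\<forall>\<tau>. V\<^sub>2 \<tau> = V\<^sub>1 (- \<tau>))
      \<and> (\<forall>V\<in>{V\<^sub>1, V\<^sub>2}. bounces_at V 0 \<and> (\<forall>\<tau>. Vc \<le> V \<tau>) \<and> \<not> (\<forall>\<tau>. V (- \<tau>) = V \<tau>))"
proof -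
  let ?V = "bounce_volume Vc" and ?b = "bounce_angle Vc"
  \<comment> \<open>Independence is linear independence: time \<open>0\<close> gives
    \<open>c\<^sub>2 = - c\<^sub>1\<close>, and a time at which the volume differs from its
    reflection gives \<open>c\<^sub>1 = 0\<close>.\<close>
  have indep: "c\<^sub>1 = 0 \<and> c\<^sub>2 = 0" if lin: "\<forall>\<tau>. c\<^sub>1 * ?V 1 \<tau> + c\<^sub>2 * ?V (-1) \<tau> = 0" for c\<^sub>1 c\<^sub>2
  proof -
    have sol: "bounce_solution \<beta> \<kappa> Vc (?V 1) (\<lambda>\<tau>. 0 + ?b 1 \<tau>)"
      by (rule bounce_solution_flow[OF assms]) auto
    then have "?V 1 0 = Vc" by (simp add: bounce_solution_def)
    then have "(c\<^sub>1 + c\<^sub>2) * Vc = 0"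
      using lin[rule_format, of 0] by (simp add: bounce_volume_reflect algebra_simps)
    then have c: "c\<^sub>2 = - c\<^sub>1" using assms by simp
    obtain \<tau> where "?V 1 (- \<tau>) \<noteq> ?V 1 \<tau>" using bounce_not_symmetric[OF sol] by blast
    moreover have "c\<^sub>1 * (?V 1 \<tau> - ?V 1 (- \<tau>)) = 0"
      using lin[rule_format, of \<tau>] by (simp add: c bounce_volume_reflect algebra_simps)
    ultimately show ?thesis using c by auto
  qed
  have bounce: "bounces_at V 0 \<and> (\<forall>\<tau>. Vc \<le> V \<tau>) \<and> \<not> (\<forall>\<tau>. V (- \<tau>) = V \<tau>)" if V: "V \<in> {?V 1, ?V (-1)}" for V
  proof -
    obtain b where "bounce_solution \<beta> \<kappa> Vc V b"
      using V bounce_volumes[OF assms] by auto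
    then show ?thesis using bounce_solution_bounces bounce_not_symmetric by blast
  qed
  show ?thesis
  proof (intro exI conjI)
    show "{(V, b). bounce_solution \<beta> \<kappa> Vc V b \<and> (\<forall>\<tau>. b \<tau> \<in> {-pi/2..pi/2})}
        = {(?V 1, ?b 1), (?V (-1), ?b (-1))}"
      by (rule bounded_bounce_solutions[OF assms])
    show "{V. \<exists>b. bounce_solution \<beta> \<kappa> Vc V b} = {?V 1, ?V (-1)}"
      by (rule bounce_volumes[OF assms])
    show "?b 1 0 = arcsin (critical_sine \<beta>)" "?b (-1) 0 = arcsin (- critical_sine \<beta>)"
      using bounce_angle_0[of 1 Vc] bounce_angle_0[of "-1" Vc] by simp_all
    show "?b 1 0 \<noteq> ?b (-1) 0"
      using bounce_angle_bounds(1)[of 1 Vc 0] bounce_angle_bounds(1)[of "-1" Vc 0] by auto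
    show "\<forall>c\<^sub>1 c\<^sub>2. (\<forall>\<tau>. c\<^sub>1 * ?V 1 \<tau> + c\<^sub>2 * ?V (-1) \<tau> = 0) \<longrightarrow> c\<^sub>1 = 0 \<and> c\<^sub>2 = 0"
      using indep by blast
    show "\<forall>\<tau>. ?V (-1) \<tau> = ?V 1 (- \<tau>)"
      by (simp add: bounce_volume_reflect)
    show "\<forall>V\<in>{?V 1, ?V (-1)}. bounces_at V 0 \<and> (\<forall>\<tau>. Vc \<le> V \<tau>) \<and> \<not> (\<forall>\<tau>. V (- \<tau>) = V \<tau>)"
      using bounce by blast
  qed
qed

end

theorem mainTheorem5:
  fixes \<beta> \<kappa> :: real
  assumes "0 < \<beta>" and "0 < \<kappa>"
  shows
    \<comment> \<open>conservation of the energy\<close>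
    "(\<forall>I V b. effective_solution \<beta> I V b \<longrightarrow>
        (\<exists>E. \<forall>\<tau>\<in>I. energy \<beta> \<kappa> (V \<tau>) (b \<tau>) = E))
   \<and>
    \<comment> \<open>(a) the branches\<close>
     (\<forall>V \<rho>. \<forall>b\<in>{-pi/2..pi/2}. 0 < V \<longrightarrow> 0 < \<rho> \<longrightarrow>
        (energy \<beta> \<kappa> V b = \<rho> * V \<longleftrightarrow>
          0 \<le> discr \<beta> \<kappa> V \<rho> \<and> (\<exists>r. \<exists>\<sigma>\<in>{1, -1}. b = branch_angle \<beta> \<kappa> r \<sigma> V \<rho>)))
   \<and> (\<forall>I V b. effective_solution \<beta> I V b \<longrightarrow>
        (\<forall>\<tau>\<in>I. \<forall>r. \<forall>\<sigma>\<in>{1, -1}.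
          let \<rho> = dust_density \<beta> \<kappa> (V \<tau>) (b \<tau>) in
            b \<tau> \<in> {-pi/2..pi/2} \<longrightarrow> 0 < \<rho> \<longrightarrow> b \<tau> = branch_angle \<beta> \<kappa> r \<sigma> (V \<tau>) \<rho> \<longrightarrow>
              (V has_real_derivative branch_rate \<beta> \<kappa> r \<sigma> (V \<tau>) \<rho>) (at \<tau>)))
   \<and>
    \<comment> \<open>(b) Hubble rate of the scale factor, also in the rescaled time \<open>c \<tau>\<close>, and low density\<close>
     (\<forall>I V b. effective_solution \<beta> I V b \<longrightarrow>
        (\<forall>\<tau>\<in>I. \<forall>r. \<forall>\<sigma>\<in>{1, -1}. on_branch \<beta> \<kappa> r \<sigma> V b \<tau> \<longrightarrow>
          (\<forall>c>0. ((\<lambda>t. V (t / c) powr (1/3)) has_real_derivative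
              hubble \<beta> \<kappa> r \<sigma> (V \<tau>) (dust_density \<beta> \<kappa> (V \<tau>) (b \<tau>)) / c * V \<tau> powr (1/3))
            (at (c * \<tau>)))))
   \<and> (\<forall>\<sigma>\<in>{1, -1}.
        (\<lambda>(V, \<rho>). (hubble \<beta> \<kappa> BranchA \<sigma> V \<rho>)\<^sup>2)
          \<sim>[low_density] (\<lambda>(V, \<rho>). 2 * (16 + 7 * \<beta>\<^sup>2) / 81 * \<kappa> * \<rho>))
   \<and> \<comment> \<open>the standard form \<open>8 \<pi> G \<rho> / 3 = \<kappa> \<rho> / 6\<close> after rescaling\<close>
     (\<exists>c>0. \<forall>\<sigma>\<in>{1, -1}.
        (\<lambda>(V, \<rho>). (hubble \<beta> \<kappa> BranchA \<sigma> V \<rho> / c)\<^sup>2)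
          \<sim>[low_density] (\<lambda>(V, \<rho>). \<kappa> * \<rho> / 6))
   \<and> (\<forall>\<sigma>\<in>{1, -1}.
        (\<lambda>(V, \<rho>). (hubble \<beta> \<kappa> BranchB \<sigma> V \<rho>)\<^sup>2
            - ((7 * \<beta>\<^sup>2 + 16) ^ 3 / (1296 * (\<beta>\<^sup>2 + 1)\<^sup>2 * (V powr (1/3))\<^sup>2)
              + (- 19 * \<beta>\<^sup>2 + 8) * (7 * \<beta>\<^sup>2 + 16) * \<kappa> * \<rho> / (324 * (\<beta>\<^sup>2 + 1))))
          \<in> o[low_density](\<lambda>(V, \<rho>). \<rho>))
   \<and>
    \<comment> \<open>(c) every solution extends to all times, and there it bounces\<close>
     (\<forall>I V b. effective_solution \<beta> I V b \<and> (\<forall>\<tau>\<in>I. 0 < dust_density \<beta> \<kappa> (V \<tau>) (b \<tau>)) \<longrightarrow>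
        (\<exists>V' b'. effective_solution \<beta> UNIV V' b' \<and> (\<forall>\<tau>\<in>I. V' \<tau> = V \<tau> \<and> b' \<tau> = b \<tau>)))
   \<and> (\<forall>V b E. effective_solution \<beta> UNIV V b \<and>
          (\<forall>\<tau>. 0 < dust_density \<beta> \<kappa> (V \<tau>) (b \<tau>)) \<and> (\<forall>\<tau>. energy \<beta> \<kappa> (V \<tau>) (b \<tau>) = E) \<longrightarrow>
        (\<exists>t. bounces_at V t
           \<and> strict_mono_on {..t} (\<lambda>\<tau>. dust_density \<beta> \<kappa> (V \<tau>) (b \<tau>))
           \<and> strict_antimono_on {t..} (\<lambda>\<tau>. dust_density \<beta> \<kappa> (V \<tau>) (b \<tau>))
           \<and> V t = critical_volume \<beta> \<kappa> E \<and> 0 < critical_volume \<beta> \<kappa> E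
           \<and> dust_density \<beta> \<kappa> (V t) (b t) = E / critical_volume \<beta> \<kappa> E
           \<and> sin (b t) \<in> {critical_sine \<beta>, - critical_sine \<beta>}
           \<and> ((\<forall>\<tau>. b \<tau> \<in> {-pi/2..pi/2}) \<longrightarrow>
                (sin (b t) = critical_sine \<beta> \<longrightarrow>
                  (\<forall>\<tau><t. on_branch \<beta> \<kappa> BranchB 1 V b \<tau>) \<and>
                  (\<forall>\<tau>>t. on_branch \<beta> \<kappa> BranchA 1 V b \<tau>)) \<and>
                (sin (b t) = - critical_sine \<beta> \<longrightarrow>
                  (\<forall>\<tau><t. on_branch \<beta> \<kappa> BranchA (-1) V b \<tau>) \<and>
                  (\<forall>\<tau>>t. on_branch \<beta> \<kappa> BranchB (-1) V b \<tau>)))))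
   \<and> \<comment> \<open>continuity of \<open>sin b\<close> at the bounce allows only the connections between A and B\<close>
     (\<forall>V b E \<epsilon> r\<^sub>1 r\<^sub>2. \<forall>\<sigma>\<^sub>1\<in>{1, -1}. \<forall>\<sigma>\<^sub>2\<in>{1, -1}.
        0 < E \<and> 0 < \<epsilon> \<and> V 0 = critical_volume \<beta> \<kappa> E \<and> isCont V 0 \<and>
        (\<forall>\<tau>. \<bar>\<tau>\<bar> < \<epsilon> \<longrightarrow> energy \<beta> \<kappa> (V \<tau>) (b \<tau>) = E) \<and>
        (\<forall>\<tau>. 0 < \<bar>\<tau>\<bar> \<and> \<bar>\<tau>\<bar> < \<epsilon> \<longrightarrow> V 0 < V \<tau>) \<and>
        (\<forall>\<tau>. -\<epsilon> < \<tau> \<and> \<tau> < 0 \<longrightarrow> on_branch \<beta> \<kappa> r\<^sub>1 \<sigma>\<^sub>1 V b \<tau>) \<and>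
        (\<forall>\<tau>. 0 < \<tau> \<and> \<tau> < \<epsilon> \<longrightarrow> on_branch \<beta> \<kappa> r\<^sub>2 \<sigma>\<^sub>2 V b \<tau>) \<and>
        isCont (\<lambda>\<tau>. sin (b \<tau>)) 0 \<longrightarrow>
          (r\<^sub>1 = BranchB \<and> \<sigma>\<^sub>1 = 1 \<and> r\<^sub>2 = BranchA \<and> \<sigma>\<^sub>2 = 1) \<or>
          (r\<^sub>1 = BranchA \<and> \<sigma>\<^sub>1 = -1 \<and> r\<^sub>2 = BranchB \<and> \<sigma>\<^sub>2 = -1))
   \<and>
    \<comment> \<open>(d) the two unsymmetric bouncing solutions\<close>
     (\<forall>Vc>0. \<exists>V\<^sub>1 b\<^sub>1 V\<^sub>2 b\<^sub>2.
        {(V, b). bounce_solution \<beta> \<kappa> Vc V b \<and> (\<forall>\<tau>. b \<tau> \<in> {-pi/2..pi/2})}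
          = {(V\<^sub>1, b\<^sub>1), (V\<^sub>2, b\<^sub>2)}
      \<and> {V. \<exists>b. bounce_solution \<beta> \<kappa> Vc V b} = {V\<^sub>1, V\<^sub>2}
      \<and> b\<^sub>1 0 = arcsin (critical_sine \<beta>) \<and> b\<^sub>2 0 = arcsin (- critical_sine \<beta>) \<and> b\<^sub>1 0 \<noteq> b\<^sub>2 0
      \<and> (\<forall>c\<^sub>1 c\<^sub>2. (\<forall>\<tau>. c\<^sub>1 * V\<^sub>1 \<tau> + c\<^sub>2 * V\<^sub>2 \<tau> = 0) \<longrightarrow> c\<^sub>1 = 0 \<and> c\<^sub>2 = 0)
      \<and> (\<forall>\<tau>. V\<^sub>2 \<tau> = V\<^sub>1 (- \<tau>))
      \<and> (\<forall>V\<in>{V\<^sub>1, V\<^sub>2}. bounces_at V 0 \<and> (\<forall>\<tau>. Vc \<le> V \<tau>) \<and> \<not> (\<forall>\<tau>. V (- \<tau>) = V \<tau>)))"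
proof -
  interpret dust_model \<beta> \<kappa> using assms by unfold_locales
  show ?thesis
    unfolding Let_def
  proof (intro conjI allI ballI impI)
    fix I V b assume "effective_solution \<beta> I V b"
    then obtain E where "\<And>\<tau>. \<tau> \<in> I \<Longrightarrow> energy \<beta> \<kappa> (V \<tau>) (b \<tau>) = E"
      by (rule energy_conserved) blast
    then show "\<exists>E. \<forall>\<tau>\<in>I. energy \<beta> \<kappa> (V \<tau>) (b \<tau>) = E" by blast
  next
    fix V \<rho> b :: real assume "b \<in> {-pi/2..pi/2}" "0 < V" "0 < \<rho>"
    then show "energy \<beta> \<kappa> V b = \<rho> * V \<longleftrightarrow>
        0 \<le> discr \<beta> \<kappa> V \<rho> \<and> (\<exists>r. \<exists>\<sigma>\<in>{1, -1}. b = branch_angle \<beta> \<kappa> r \<sigma> V \<rho>)"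
      by (intro energy_iff_branch)
  next
    fix I V b \<tau> r and \<sigma> :: real
    assume sol: "effective_solution \<beta> I V b" "\<tau> \<in> I" and *: "\<sigma> \<in> {1, -1}" "b \<tau> \<in> {-pi/2..pi/2}"
      "0 < dust_density \<beta> \<kappa> (V \<tau>) (b \<tau>)"
      "b \<tau> = branch_angle \<beta> \<kappa> r \<sigma> (V \<tau>) (dust_density \<beta> \<kappa> (V \<tau>) (b \<tau>))"
    note solD = effective_solutionD[OF sol]
    from branch_rate_eq_V_rhs[OF solD(1) *(2,3,1,4)] solD(2)
    show "(V has_real_derivative branch_rate \<beta> \<kappa> r \<sigma> (V \<tau>) (dust_density \<beta> \<kappa> (V \<tau>) (b \<tau>))) (at \<tau>)"
      by simp
  next
    fix I V b \<tau> r and \<sigma> c :: real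
    assume "effective_solution \<beta> I V b" "\<tau> \<in> I" "\<sigma> \<in> {1, -1}" "on_branch \<beta> \<kappa> r \<sigma> V b \<tau>" "0 < c"
    then show "((\<lambda>t. V (t / c) powr (1/3)) has_real_derivative
        hubble \<beta> \<kappa> r \<sigma> (V \<tau>) (dust_density \<beta> \<kappa> (V \<tau>) (b \<tau>)) / c * V \<tau> powr (1/3)) (at (c * \<tau>))"
      by (intro scale_factor_derivative)
  next
    fix \<sigma> :: real assume "\<sigma> \<in> {1, -1}"
    from hubble_A_asymp[OF this]
    show "(\<lambda>(V, \<rho>). (hubble \<beta> \<kappa> BranchA \<sigma> V \<rho>)\<^sup>2)
          \<sim>[low_density] (\<lambda>(V, \<rho>). 2 * (16 + 7 * \<beta>\<^sup>2) / 81 * \<kappa> * \<rho>)"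
      unfolding q_def add.commute[of "7 * \<beta>\<^sup>2"] .
  next
    obtain c where "0 < c" "\<And>\<sigma>. \<sigma> \<in> {1, -1} \<Longrightarrow>
        (\<lambda>(V, \<rho>). (hubble \<beta> \<kappa> BranchA \<sigma> V \<rho> / c)\<^sup>2) \<sim>[low_density] (\<lambda>(V, \<rho>). \<kappa> * \<rho> / 6)"
      by (rule hubble_A_asymp_rescaled) blast
    then show "\<exists>c>0. \<forall>\<sigma>\<in>{1, -1}. (\<lambda>(V, \<rho>). (hubble \<beta> \<kappa> BranchA \<sigma> V \<rho> / c)\<^sup>2)
          \<sim>[low_density] (\<lambda>(V, \<rho>). \<kappa> * \<rho> / 6)"
      by blast
  next
    fix \<sigma> :: real assume "\<sigma> \<in> {1, -1}"
    from hubble_B_asymp[OF this]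
    show "(\<lambda>(V, \<rho>). (hubble \<beta> \<kappa> BranchB \<sigma> V \<rho>)\<^sup>2
            - ((7 * \<beta>\<^sup>2 + 16) ^ 3 / (1296 * (\<beta>\<^sup>2 + 1)\<^sup>2 * (V powr (1/3))\<^sup>2)
              + (- 19 * \<beta>\<^sup>2 + 8) * (7 * \<beta>\<^sup>2 + 16) * \<kappa> * \<rho> / (324 * (\<beta>\<^sup>2 + 1))))
          \<in> o[low_density](\<lambda>(V, \<rho>). \<rho>)"
      unfolding p_def q_def .
  next
    fix I V b
    assume "effective_solution \<beta> I V b \<and> (\<forall>\<tau>\<in>I. 0 < dust_density \<beta> \<kappa> (V \<tau>) (b \<tau>))"
    then show "\<exists>V' b'. effective_solution \<beta> UNIV V' b' \<and> (\<forall>\<tau>\<in>I. V' \<tau> = V \<tau> \<and> b' \<tau> = b \<tau>)"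
      by (intro solution_extends) auto
  next
    fix V b E
    assume "effective_solution \<beta> UNIV V b \<and>
          (\<forall>\<tau>. 0 < dust_density \<beta> \<kappa> (V \<tau>) (b \<tau>)) \<and> (\<forall>\<tau>. energy \<beta> \<kappa> (V \<tau>) (b \<tau>) = E)"
    then show "\<exists>t. bounces_at V t
           \<and> strict_mono_on {..t} (\<lambda>\<tau>. dust_density \<beta> \<kappa> (V \<tau>) (b \<tau>))
           \<and> strict_antimono_on {t..} (\<lambda>\<tau>. dust_density \<beta> \<kappa> (V \<tau>) (b \<tau>))
           \<and> V t = critical_volume \<beta> \<kappa> E \<and> 0 < critical_volume \<beta> \<kappa> E
           \<and> dust_density \<beta> \<kappa> (V t) (b t) = E / critical_volume \<beta> \<kappa> E
           \<and> sin (b t) \<in> {critical_sine \<beta>, - critical_sine \<beta>}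
           \<and> ((\<forall>\<tau>. b \<tau> \<in> {-pi/2..pi/2}) \<longrightarrow>
                (sin (b t) = critical_sine \<beta> \<longrightarrow>
                  (\<forall>\<tau><t. on_branch \<beta> \<kappa> BranchB 1 V b \<tau>) \<and>
                  (\<forall>\<tau>>t. on_branch \<beta> \<kappa> BranchA 1 V b \<tau>)) \<and>
                (sin (b t) = - critical_sine \<beta> \<longrightarrow>
                  (\<forall>\<tau><t. on_branch \<beta> \<kappa> BranchA (-1) V b \<tau>) \<and>
                  (\<forall>\<tau>>t. on_branch \<beta> \<kappa> BranchB (-1) V b \<tau>)))"
      by (intro solution_bounces) auto
  next
    fix V b and E \<epsilon> :: real and r\<^sub>1 r\<^sub>2 and \<sigma>\<^sub>1 \<sigma>\<^sub>2 :: real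
    assume \<sigma>: "\<sigma>\<^sub>1 \<in> {1, -1}" "\<sigma>\<^sub>2 \<in> {1, -1}"
      and *: "0 < E \<and> 0 < \<epsilon> \<and> V 0 = critical_volume \<beta> \<kappa> E \<and> isCont V 0 \<and>
        (\<forall>\<tau>. \<bar>\<tau>\<bar> < \<epsilon> \<longrightarrow> energy \<beta> \<kappa> (V \<tau>) (b \<tau>) = E) \<and>
        (\<forall>\<tau>. 0 < \<bar>\<tau>\<bar> \<and> \<bar>\<tau>\<bar> < \<epsilon> \<longrightarrow> V 0 < V \<tau>) \<and>
        (\<forall>\<tau>. -\<epsilon> < \<tau> \<and> \<tau> < 0 \<longrightarrow> on_branch \<beta> \<kappa> r\<^sub>1 \<sigma>\<^sub>1 V b \<tau>) \<and>
        (\<forall>\<tau>. 0 < \<tau> \<and> \<tau> < \<epsilon> \<longrightarrow> on_branch \<beta> \<kappa> r\<^sub>2 \<sigma>\<^sub>2 V b \<tau>) \<and>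
        isCont (\<lambda>\<tau>. sin (b \<tau>)) 0"
    show "(r\<^sub>1 = BranchB \<and> \<sigma>\<^sub>1 = 1 \<and> r\<^sub>2 = BranchA \<and> \<sigma>\<^sub>2 = 1) \<or>
          (r\<^sub>1 = BranchA \<and> \<sigma>\<^sub>1 = -1 \<and> r\<^sub>2 = BranchB \<and> \<sigma>\<^sub>2 = -1)"
      by (rule branch_connection[OF \<sigma>, of E \<epsilon> V b]) (use * in auto)
  next
    fix Vc :: real assume "0 < Vc"
    then show "\<exists>V\<^sub>1 b\<^sub>1 V\<^sub>2 b\<^sub>2.
        {(V, b). bounce_solution \<beta> \<kappa> Vc V b \<and> (\<forall>\<tau>. b \<tau> \<in> {-pi/2..pi/2})}
          = {(V\<^sub>1, b\<^sub>1), (V\<^sub>2, b\<^sub>2)}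
      \<and> {V. \<exists>b. bounce_solution \<beta> \<kappa> Vc V b} = {V\<^sub>1, V\<^sub>2}
      \<and> b\<^sub>1 0 = arcsin (critical_sine \<beta>) \<and> b\<^sub>2 0 = arcsin (- critical_sine \<beta>) \<and> b\<^sub>1 0 \<noteq> b\<^sub>2 0
      \<and> (\<forall>c\<^sub>1 c\<^sub>2. (\<forall>\<tau>. c\<^sub>1 * V\<^sub>1 \<tau> + c\<^sub>2 * V\<^sub>2 \<tau> = 0) \<longrightarrow> c\<^sub>1 = 0 \<and> c\<^sub>2 = 0)
      \<and> (\<forall>\<tau>. V\<^sub>2 \<tau> = V\<^sub>1 (- \<tau>))
      \<and> (\<forall>V\<in>{V\<^sub>1, V\<^sub>2}. bounces_at V 0 \<and> (\<forall>\<tau>. Vc \<le> V \<tau>) \<and> \<not> (\<forall>\<tau>. V (- \<tau>) = V \<tau>))"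
      by (rule two_bounce_solutions)
  qed
qed

end
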